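(* For $r=3$ and $p$ a constant, \[ \lim_{n\to\infty}\mathbb{P}\big(\mathcal{R}^{(3)}(n,p)\text{ is Turánnical}\big)=\begin{cases}0,&\text{if } p\le 1/2,\\ 1,&\text{if } p>1/2.\end{cases} \] For every integer $r>3$ there are $c=c(r)>0$ and $C=C(r)>0$ such that for any sequence $p=p_n$ of probabilities \[ \lim_{n\to\infty}\mathbb{P}\big(\mathcal{R}^{(r)}(n,p)\text{ is Turánnical}\big)=\begin{cases}0,&\text{if } p_n\le c\,n^{3-r}\text{ for all } n\in\mathbb{N},\\ 1,&\text{if } p_n\ge C\,n^{3-r}\text{ for all } n\in\mathbb{N}.\end{cases} \]
   Context: $\mathcal{R}^{(r)}(n,p)$ is the random $r$-uniform hypergraph on vertex set $[n]$ in which each $r$-subset of $[n]$ is a hyperedge independently with probability $p$. $t_r(n)$ denotes the number of edges of the Turán graph $T_r(n)$, the complete balanced $(r-1)$-partite graph on $n$ vertices. An $r$-uniform hypergraph $\mathcal{F}$ on vertex set $V$ detects a graph $G=(V,E)$ if some hyperedge of $\mathcal{F}$ induces a copy of $K_r$ in $G$. $\mathcal{F}$ (on $n$ vertices) is Turánnical if it detects every graph $G$ on $V$ with $e(G)>t_r(n)$. *)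

theory Defs
  imports "HOL-Probability.Product_PMF" "HOL-Library.Ramsey"
begin

text \<open>
  Graphs and \<open>r\<close>-uniform hypergraphs on a vertex set \<open>V\<close> are given by their edge sets, i.e. by
  subsets of \<open>nsets V 2\<close> and \<open>nsets V r\<close>, where \<open>nsets V k\<close> is the set of \<open>k\<close>-element subsets
  of \<open>V\<close>.
\<close>

text \<open>
  The complete balanced \<open>(r - 1)\<close>-partite graph on \<open>{1..n}\<close>: the parts are the residue classes
  modulo \<open>r - 1\<close>, whose sizes within \<open>{1..n}\<close> differ by at most one. Meant for \<open>r \<ge> 2\<close>.
\<close>

definition turan_graph :: "nat \<Rightarrow> nat \<Rightarrow> nat set set" where
  "turan_graph r n = {{x, y} | x y. x \<in> {1..n} \<and> y \<in> {1..n} \<and> x mod (r - 1) \<noteq> y mod (r - 1)}"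

definition turan_number :: "nat \<Rightarrow> nat \<Rightarrow> nat" where
  "turan_number r n = card (turan_graph r n)"

definition induced_edges :: "'a set set \<Rightarrow> 'a set \<Rightarrow> 'a set set" where
  "induced_edges E S = {e \<in> E. e \<subseteq> S}"

text \<open>
  A set \<open>S\<close> induces a copy of the complete graph on \<open>r\<close> vertices iff it has \<open>r\<close> elements and
  the induced subgraph has all pairs of elements of \<open>S\<close> as edges.
\<close>

definition induces_complete :: "nat \<Rightarrow> 'a set set \<Rightarrow> 'a set \<Rightarrow> bool" where
  "induces_complete r E S \<longleftrightarrow> finite S \<and> card S = r \<and> induced_edges E S = nsets S 2"

definition detects :: "nat \<Rightarrow> 'a set set \<Rightarrow> 'a set set \<Rightarrow> bool" where
  "detects r F E \<longleftrightarrow> (\<exists>S\<in>F. induces_complete r E S)"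

definition turannical :: "nat \<Rightarrow> 'a set \<Rightarrow> 'a set set \<Rightarrow> bool" where
  "turannical r V F \<longleftrightarrow>
     (\<forall>E. E \<subseteq> nsets V 2 \<and> card E > turan_number r (card V) \<longrightarrow> detects r F E)"

text \<open>
  The independent Bernoulli variables are indexed by the \<open>r\<close>-subsets of \<open>{1..n}\<close>, and the
  hypergraph consists of those with outcome \<open>True\<close>. Meant for \<open>0 \<le> p \<le> 1\<close>, since
  \<open>bernoulli_pmf\<close> truncates its parameter to that range.
\<close>

definition random_hypergraph :: "nat \<Rightarrow> nat \<Rightarrow> real \<Rightarrow> nat set set pmf" where
  "random_hypergraph r n p =
     map_pmf (\<lambda>f. {S \<in> nsets {1..n} r. f S})
       (Pi_pmf (nsets {1..n} r) False (\<lambda>_. bernoulli_pmf p))"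

definition prob_turannical :: "nat \<Rightarrow> nat \<Rightarrow> real \<Rightarrow> real" where
  "prob_turannical r n p =
     measure_pmf.prob (random_hypergraph r n p) {F. turannical r {1..n} F}"

end

theory Submission
  imports Defs "HOL-Probability.Hoeffding" "HOL-Real_Asymp.Real_Asymp"
begin

text \<open>
  If few hyperedges contain a pair \<open>uv\<close>, one can choose a Turan graph with a class containing
  \<open>u\<close>, \<open>v\<close> and a further vertex of each of these hyperedges; adding the edge \<open>uv\<close> then yields an
  undetected graph. This gives both 0-statements.

  For the 1-statements the main point is deterministic: a graph with more than \<open>t\<^sub>r(n)\<close> edges
  at edit distance \<open>d\<close> from some complete \<open>(r - 1)\<close>-partite graph contains at least
  \<open>c d n ^ (r - 2)\<close> copies of \<open>K\<^sub>r\<close>. A fixed graph of this kind is undetected with probability at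
  most \<open>exp (- p c d n ^ (r - 2))\<close>, which for \<open>p n ^ (r - 3)\<close> large beats the number
  \<open>(r - 1) ^ n * (n choose 2) ^ d\<close> of choices of a partition and of the \<open>d\<close> modified pairs. For
  \<open>r = 3\<close> and \<open>p\<close> constant this works for \<open>d \<ge> L\<close> with \<open>L\<close> a constant; if \<open>d < L\<close>, an edge inside a part is in
  linearly many hyperedges with third vertex in the other part, because all codegrees exceed
  \<open>(1 / 2 + \<epsilon>) n\<close>, and the fewer than \<open>L\<close> missing edges cannot destroy all these triangles.
\<close>

section \<open>Pairs and cliques\<close>

text \<open>The clique bound must be linear in d because about n ^ (2 d) graphs lie at a fixed
  distance d from a given partition. Stability settles graphs whose distance is of order n ^ 2: they
  have of the order of n ^ r cliques. Closer graphs are compared with a partition that has the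
  fewest edges inside classes. Being above the Turan number, they have more inner edges than missing
  cross pairs, so inner edges make up more than half of d, and about n ^ (r - 2) cliques per inner
  edge on average are enough.

  The case r = 3 is special since p <= 1 caps the exponent: for small d, p c d n need not exceed n
  ln 2. The value 1 / 2 appears because a class of the bipartite Turan graph has about n / 2
  vertices while a codegree is about p n. At p = 1 / 2 a single pair is only known to have small
  codegree with probability bounded away from 0, so about n / 2 independent pairs are used. For r >
  3 the constant c keeps the mean codegree well below the class size, and one pair suffices.\<close>

definition pair_count :: "('a \<Rightarrow> 'b \<Rightarrow> bool) \<Rightarrow> 'a set \<Rightarrow> 'b set \<Rightarrow> nat" where
  "pair_count P A B = card {(x, y). x \<in> A \<and> y \<in> B \<and> P x y}"

lemma finite_pair_set [simp]:
  "finite A \<Longrightarrow> finite B \<Longrightarrow> finite {(x, y). x \<in> A \<and> y \<in> B \<and> P x y}"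
  by (rule finite_subset[of _ "A \<times> B"]) auto

lemma pair_count_sum:
  assumes "finite A" "finite B"
  shows "pair_count P A B = (\<Sum>x\<in>A. card {y \<in> B. P x y})"
proof -
  have "{(x, y). x \<in> A \<and> y \<in> B \<and> P x y} = Sigma A (\<lambda>x. {y \<in> B. P x y})" by auto
  thus ?thesis using assms by (simp add: pair_count_def)
qed

lemma pair_count_swap: "pair_count P A B = pair_count (\<lambda>x y. P y x) B A"
  unfolding pair_count_def
  by (rule bij_betw_same_card[of prod.swap]) (auto intro!: bij_betwI[of _ _ _ prod.swap])

lemma pair_count_sum':
  assumes "finite A" "finite B"
  shows "pair_count P A B = (\<Sum>y\<in>B. card {x \<in> A. P x y})"
  by (subst pair_count_swap) (rule pair_count_sum[OF assms(2,1)])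

lemma pair_count_cong:
  "(\<And>x y. x \<in> A \<Longrightarrow> y \<in> B \<Longrightarrow> P x y = Q x y) \<Longrightarrow> pair_count P A B = pair_count Q A B"
  unfolding pair_count_def by (rule arg_cong[of _ _ card]) auto

lemma pair_count_mono:
  assumes "finite A" "finite B" "\<And>x y. x \<in> A \<Longrightarrow> y \<in> B \<Longrightarrow> P x y \<Longrightarrow> Q x y"
  shows "pair_count P A B \<le> pair_count Q A B"
  unfolding pair_count_def by (rule card_mono) (use assms in auto)

lemma pair_count_True: "finite A \<Longrightarrow> finite B \<Longrightarrow> pair_count (\<lambda>_ _. True) A B = card A * card B"
  by (simp add: pair_count_sum)

lemma pair_count_False [simp]: "pair_count (\<lambda>_ _. False) A B = 0"
  by (simp add: pair_count_def)

lemma pair_count_le: "finite A \<Longrightarrow> finite B \<Longrightarrow> pair_count P A B \<le> card A * card B"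
  using pair_count_mono[of A B P "\<lambda>_ _. True"] by (simp add: pair_count_True)

lemma pair_count_Un_left:
  assumes "finite A" "finite A'" "finite B" "A \<inter> A' = {}"
  shows "pair_count P (A \<union> A') B = pair_count P A B + pair_count P A' B"
  using assms by (simp add: pair_count_sum sum.union_disjoint)

lemma pair_count_Un_right:
  assumes "finite A" "finite B" "finite B'" "B \<inter> B' = {}"
  shows "pair_count P A (B \<union> B') = pair_count P A B + pair_count P A B'"
  using assms by (simp add: pair_count_sum' sum.union_disjoint)

lemma pair_count_Un_square:
  assumes "finite A" "finite B" "A \<inter> B = {}" and sym: "\<And>x y. P x y = P y x"
  shows "pair_count P (A \<union> B) (A \<union> B) = pair_count P A A + 2 * pair_count P A B + pair_count P B B"
proof -
  have "pair_count P B A = pair_count P A B"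
    by (subst pair_count_swap) (rule pair_count_cong, simp add: sym)
  thus ?thesis using assms by (simp add: pair_count_Un_left pair_count_Un_right)
qed

lemma pair_count_split:
  assumes "finite A" "finite B"
  shows "pair_count P A B = pair_count (\<lambda>x y. P x y \<and> Q x y) A B + pair_count (\<lambda>x y. P x y \<and> \<not> Q x y) A B"
  unfolding pair_count_def
  by (subst card_Un_disjoint[symmetric]) (use assms in \<open>auto intro!: arg_cong[of _ _ card]\<close>)

section \<open>Graphs, neighbourhoods and counting cliques by their vertices\<close>

definition graph :: "'a set set \<Rightarrow> bool" where
  "graph E \<longleftrightarrow> E \<subseteq> nsets UNIV 2"

lemma graph_no_loop: "graph E \<Longrightarrow> {x, y} \<in> E \<Longrightarrow> x \<noteq> y"
  by (auto simp: graph_def nsets_def)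

abbreviation adj :: "'a set set \<Rightarrow> 'a \<Rightarrow> 'a \<Rightarrow> bool" where
  "adj E x y \<equiv> {x, y} \<in> E"

definition nbrs :: "'a set set \<Rightarrow> 'a set \<Rightarrow> 'a \<Rightarrow> 'a set" where
  "nbrs E W x = {y \<in> W. adj E x y}"

lemma nbrs_subset: "nbrs E W x \<subseteq> W" by (auto simp: nbrs_def)

lemma finite_nbrs [simp]: "finite W \<Longrightarrow> finite (nbrs E W x)" by (simp add: nbrs_def)

text \<open>The vertex set \<open>W\<close> is kept apart from the edge set, so that a neighbourhood
  or a union of classes can be passed without restricting \<open>E\<close>.\<close>

definition cliques :: "nat \<Rightarrow> 'a set set \<Rightarrow> 'a set \<Rightarrow> 'a set set" where
  "cliques r E W = {S \<in> nsets W r. nsets S 2 \<subseteq> E}"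

lemma finite_cliques [simp]: "finite W \<Longrightarrow> finite (cliques r E W)"
  by (simp add: cliques_def finite_imp_finite_nsets)

lemma cliques_mono: "A \<subseteq> B \<Longrightarrow> cliques r E A \<subseteq> cliques r E B"
  using nsets_mono[of A B r] by (auto simp: cliques_def)

lemma nsets_2_insert: "nsets (insert x S) 2 = nsets S 2 \<union> {{x, y} |y. y \<in> S - {x}}"
  by (auto simp: nsets_2_eq insert_commute)

lemma card_cliques_through:
  assumes "graph E" "x \<in> W"
  shows "card {S \<in> cliques (Suc k) E W. x \<in> S} = card (cliques k E (nbrs E W x))"
proof (rule sym, rule bij_betw_same_card, rule bij_betwI[of "insert x" _ _ "\<lambda>S. S - {x}"])
  have x: "x \<notin> nbrs E W x" using graph_no_loop[OF assms(1), of x x] by (auto simp: nbrs_def)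
  show "insert x \<in> cliques k E (nbrs E W x) \<rightarrow> {S \<in> cliques (Suc k) E W. x \<in> S}"
  proof
    fix S assume S: "S \<in> cliques k E (nbrs E W x)"
    hence "x \<notin> S" using x by (auto simp: cliques_def nsets_def)
    thus "insert x S \<in> {S \<in> cliques (Suc k) E W. x \<in> S}"
      using S assms by (auto simp: cliques_def nsets_2_insert) (auto simp: nsets_def nbrs_def)
  qed
  show "(\<lambda>S. S - {x}) \<in> {S \<in> cliques (Suc k) E W. x \<in> S} \<rightarrow> cliques k E (nbrs E W x)"
  proof
    fix S assume "S \<in> {S \<in> cliques (Suc k) E W. x \<in> S}"
    hence S: "S \<subseteq> W" "finite S" "card S = Suc k" "x \<in> S" and E: "nsets S 2 \<subseteq> E"
      by (auto simp: cliques_def nsets_def)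
    have "{x, y} \<in> E" if "y \<in> S - {x}" for y
      using E S(4) that by auto
    moreover have "nsets (S - {x}) 2 \<subseteq> E" using E nsets_mono[of "S - {x}" S 2] by auto
    ultimately show "S - {x} \<in> cliques k E (nbrs E W x)"
      using S by (auto simp: cliques_def nsets_def nbrs_def)
  qed
  show "insert x S - {x} = S" if "S \<in> cliques k E (nbrs E W x)" for S
    using that x by (auto simp: cliques_def nsets_def)
  show "insert x (S - {x}) = S" if "S \<in> {S \<in> cliques (Suc k) E W. x \<in> S}" for S
    using that by auto
qed

text \<open>Every clique is counted once from each of its vertices. This links clique counts of
  consecutive sizes: \<open>stability\<close> uses it to descend to a neighbourhood,
  \<open>near_turan_cliques\<close> to climb from vertices and from pairs to cliques.\<close>

lemma sum_card_cliques_nbrs: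
  assumes "graph E" "finite W"
  shows "(\<Sum>x\<in>W. card (cliques k E (nbrs E W x))) = Suc k * card (cliques (Suc k) E W)"
proof -
  have "(\<Sum>x\<in>W. card (cliques k E (nbrs E W x))) = (\<Sum>x\<in>W. card {S \<in> cliques (Suc k) E W. x \<in> S})"
    using assms by (intro sum.cong) (simp_all add: card_cliques_through)
  also have "\<dots> = (\<Sum>S\<in>cliques (Suc k) E W. Suc k)"
  proof (rule sum_multicount_gen)
    show "\<forall>S\<in>cliques (Suc k) E W. card {x \<in> W. x \<in> S} = Suc k"
    proof
      fix S assume "S \<in> cliques (Suc k) E W"
      hence "{x \<in> W. x \<in> S} = S" "card S = Suc k" by (auto simp: cliques_def nsets_def)
      thus "card {x \<in> W. x \<in> S} = Suc k" by simp
    qed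
  qed (use assms in auto)
  finally show ?thesis by simp
qed

lemma card_mult_le_sum:
  fixes g :: "'a \<Rightarrow> real"
  assumes "finite W" "B \<subseteq> W" "\<And>x. x \<in> W \<Longrightarrow> g x \<ge> 0" "\<And>x. x \<in> B \<Longrightarrow> g x \<ge> c"
  shows "real (card B) * c \<le> (\<Sum>x\<in>W. g x)"
proof -
  have "real (card B) * c \<le> (\<Sum>x\<in>B. g x)"
    using sum_mono[of B "\<lambda>_. c" g] assms by simp
  also have "\<dots> \<le> (\<Sum>x\<in>W. g x)" by (rule sum_mono2) (use assms in auto)
  finally show ?thesis .
qed

lemma finite_ex_max:
  fixes f :: "'a \<Rightarrow> nat"
  assumes "finite A" "A \<noteq> {}"
  shows "\<exists>x\<in>A. \<forall>y\<in>A. f y \<le> f x"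
proof -
  have "Max (f ` A) \<in> f ` A" using assms by simp
  then obtain x where "x \<in> A" "f x = Max (f ` A)" by auto
  thus ?thesis using assms(1) by (intro bexI[of _ x]) auto
qed

section \<open>Stability: few cliques force a good partition\<close>

abbreviation edge_pairs :: "'a set set \<Rightarrow> 'a set \<Rightarrow> nat" where
  "edge_pairs E W \<equiv> pair_count (adj E) W W"

abbreviation inner_pairs :: "'a set set \<Rightarrow> ('a \<Rightarrow> nat) \<Rightarrow> 'a set \<Rightarrow> nat" where
  "inner_pairs E f W \<equiv> pair_count (\<lambda>x y. adj E x y \<and> f x = f y) W W"

abbreviation cross_pairs :: "('a \<Rightarrow> nat) \<Rightarrow> 'a set \<Rightarrow> nat" where
  "cross_pairs f W \<equiv> pair_count (\<lambda>x y. f x \<noteq> f y) W W"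

text \<open>
  Furedi's argument. A vertex in few \<open>(k + 1)\<close>-cliques and of maximal degree among such
  vertices is chosen; its non-neighbours form a new class, and the induction hypothesis applies to
  its neighbourhood.
\<close>

lemma stability:
  fixes e :: real
  assumes "k \<ge> 1" "e > 0"
  shows "\<exists>d>0. \<forall>n (W :: 'a set) E. graph E \<longrightarrow> finite W \<longrightarrow> card W \<le> n \<longrightarrow>
           real (card (cliques (Suc k) E W)) \<le> d * real n ^ Suc k \<longrightarrow>
           (\<exists>f \<in> W \<rightarrow> {..<k}. real (edge_pairs E W) + real (inner_pairs E f W)
                 \<le> real (cross_pairs f W) + e * real n ^ 2)"
  using assms
proof (induction k arbitrary: e rule: nat_induct_at_least)
  case base
  show ?case
  \<comment> \<open>With one class all edges are inner, so the left side is twice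
    \<open>edge_pairs\<close>, that is, four times the number of edges.\<close>
  proof (intro exI[of _ "e / 4"] conjI allI impI)
    show "e / 4 > 0" using base by simp
    fix n W and E :: "'a set set"
    assume W: "graph E" "finite W" "card W \<le> n"
      and le: "real (card (cliques (Suc 1) E W)) \<le> e / 4 * real n ^ Suc 1"
    have "edge_pairs E W = (\<Sum>x\<in>W. card (cliques 1 E (nbrs E W x)))"
    proof -
      have "card (cliques 1 E (nbrs E W x)) = card {y \<in> W. adj E x y}" for x
      proof -
        have "cliques 1 E (nbrs E W x) = (\<lambda>y. {y}) ` {y \<in> W. adj E x y}"
          by (auto simp: cliques_def nsets_def nbrs_def card_1_singleton_iff numeral_2_eq_2 card_gt_0_iff)
            (metis One_nat_def Suc_n_not_le_n card.empty card.insert card_mono finite.emptyI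
              finite_insert insert_absorb insert_not_empty)
        thus ?thesis by (simp add: card_image)
      qed
      thus ?thesis using W by (simp add: pair_count_sum)
    qed
    hence "edge_pairs E W = 2 * card (cliques (Suc 1) E W)"
      using sum_card_cliques_nbrs[OF W(1,2), of 1] by simp
    moreover have "inner_pairs E (\<lambda>_. 0) W = edge_pairs E W" by simp
    ultimately show "\<exists>f \<in> W \<rightarrow> {..<1}. real (edge_pairs E W) + real (inner_pairs E f W)
                 \<le> real (cross_pairs f W) + e * real n ^ 2"
      using le by (intro bexI[of _ "\<lambda>_. 0"]) (auto simp: power2_eq_square)
  qed
next
  case (Suc k)
  from Suc.IH[of "e / 2"] Suc.prems obtain d' where d': "d' > 0" and
    IH: "\<And>n (W :: 'a set) E. graph E \<Longrightarrow> finite W \<Longrightarrow> card W \<le> n \<Longrightarrow>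
           real (card (cliques (Suc k) E W)) \<le> d' * real n ^ Suc k \<Longrightarrow>
           \<exists>f \<in> W \<rightarrow> {..<k}. real (edge_pairs E W) + real (inner_pairs E f W)
                 \<le> real (cross_pairs f W) + e / 2 * real n ^ 2" by auto
  \<comment> \<open>Each \<open>(k + 2)\<close>-clique is seen from \<open>k + 2\<close> vertices,
    so this value leaves at most \<open>e / 4 * n\<close> vertices in the exceptional set
    \<open>B\<close> below, whose neighbourhoods have too many cliques for the induction
    hypothesis.\<close>
  define d where "d = d' * e / (4 * real (k + 2))"
  show ?case
  proof (intro exI[of _ d] conjI allI impI)
    show "d > 0" using d' Suc.prems by (simp add: d_def)
    fix n W and E :: "'a set set"
    assume W: "graph E" "finite W" "card W \<le> n"
      and le: "real (card (cliques (Suc (Suc k)) E W)) \<le> d * real n ^ Suc (Suc k)"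
    define B where "B = {x \<in> W. real (card (cliques (Suc k) E (nbrs E W x))) > d' * real n ^ Suc k}"
    have B: "B \<subseteq> W" "finite B" using W by (auto simp: B_def)
    have cardB: "real (card B) \<le> e / 4 * real n"
    proof (cases "n = 0")
      case True
      thus ?thesis using W B by (simp add: card_mono)
    next
      case False
      have "real (card B) * (d' * real n ^ Suc k) \<le> (\<Sum>x\<in>W. real (card (cliques (Suc k) E (nbrs E W x))))"
        by (rule card_mult_le_sum) (use W in \<open>auto simp: B_def\<close>)
      also have "\<dots> = real (Suc (Suc k)) * real (card (cliques (Suc (Suc k)) E W))"
        using sum_card_cliques_nbrs[OF W(1,2), of "Suc k"] by (metis of_nat_mult of_nat_sum)
      also have "\<dots> \<le> real (Suc (Suc k)) * (d * real n ^ Suc (Suc k))"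
        using le by (intro mult_left_mono) auto
      also have "\<dots> = (e / 4 * real n) * (d' * real n ^ Suc k)"
        by (simp add: d_def field_simps)
      finally show ?thesis
        using False d' by (subst (asm) mult_le_cancel_right_pos) auto
    qed
    have cardBn: "real (card B) * real n \<le> e / 4 * real n ^ 2"
      using mult_right_mono[OF cardB, of "real n"] by (simp add: power2_eq_square)
    show "\<exists>f \<in> W \<rightarrow> {..<Suc k}. real (edge_pairs E W) + real (inner_pairs E f W)
                 \<le> real (cross_pairs f W) + e * real n ^ 2"
    proof (cases "W = B")
      \<comment> \<open>All vertices are exceptional, so \<open>W\<close> is so small that a single
        colour does: even the doubled edge count stays below the error term.\<close>
      case True
      have "real (edge_pairs E W) \<le> real (card W) * real (card W)"
        using pair_count_le[OF W(2,2), of "adj E"] by (metis of_nat_le_iff of_nat_mult)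
      also have "\<dots> \<le> real (card B) * real n"
        using W True by (intro mult_mono) auto
      also note cardBn
      finally have "real (edge_pairs E W) \<le> e / 4 * real n ^ 2" .
      moreover have "e * real n ^ 2 \<ge> 0" using Suc.prems by simp
      ultimately show ?thesis by (intro bexI[of _ "\<lambda>_. 0"]) auto
    next
      case False
      hence "finite (W - B)" "W - B \<noteq> {}" using W B by auto
      then obtain x where x: "x \<in> W - B" and
        max: "\<And>y. y \<in> W - B \<Longrightarrow> card (nbrs E W y) \<le> card (nbrs E W x)"
        using finite_ex_max[of "W - B" "\<lambda>y. card (nbrs E W y)"] by blast
      define P where "P = nbrs E W x"
      define Q where "Q = W - P"
      have PQ: "W = P \<union> Q" "P \<inter> Q = {}" "finite P" "finite Q" "card P \<le> n"
        using W card_mono[OF W(2) nbrs_subset[of E W x]] by (auto simp: P_def Q_def nbrs_def)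
      have "real (card (cliques (Suc k) E P)) \<le> d' * real n ^ Suc k"
        using x by (auto simp: B_def P_def)
      from IH[OF W(1) \<open>finite P\<close> \<open>card P \<le> n\<close> this] obtain f where
        f: "f \<in> P \<rightarrow> {..<k}" and
        fle: "real (edge_pairs E P) + real (inner_pairs E f P) \<le> real (cross_pairs f P) + e / 2 * real n ^ 2"
        by auto
      define g where "g = (\<lambda>y. if y \<in> P then f y else k)"
      have gQ: "g y = k" if "y \<in> Q" for y using that by (auto simp: g_def Q_def)
      have gP: "g y = f y" "f y \<noteq> k" "g y \<noteq> k" if "y \<in> P" for y using that f by (auto simp: g_def)
      have g: "g \<in> W \<rightarrow> {..<Suc k}" using f by (auto simp: g_def less_Suc_eq)
      let ?X = "pair_count (adj E) P Q" and ?Y = "edge_pairs E Q"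
      have 1: "edge_pairs E W = edge_pairs E P + 2 * ?X + ?Y"
        unfolding PQ(1) by (rule pair_count_Un_square) (use PQ in \<open>auto simp: insert_commute\<close>)
      have 2: "inner_pairs E g W = inner_pairs E f P + ?Y"
      proof -
        have "inner_pairs E g W = inner_pairs E g P + 2 * pair_count (\<lambda>x y. adj E x y \<and> g x = g y) P Q + inner_pairs E g Q"
          unfolding PQ(1) by (rule pair_count_Un_square) (use PQ in \<open>auto simp: insert_commute\<close>)
        moreover have "inner_pairs E g P = inner_pairs E f P" by (rule pair_count_cong) (auto simp: gP)
        moreover have "pair_count (\<lambda>x y. adj E x y \<and> g x = g y) P Q = pair_count (\<lambda>_ _. False) P Q"
          by (rule pair_count_cong) (auto simp: gP gQ)
        moreover have "inner_pairs E g Q = ?Y" by (rule pair_count_cong) (auto simp: gQ)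
        ultimately show ?thesis by simp
      qed
      have 3: "cross_pairs g W = cross_pairs f P + 2 * (card P * card Q)"
      proof -
        have "cross_pairs g W = cross_pairs g P + 2 * pair_count (\<lambda>x y. g x \<noteq> g y) P Q + cross_pairs g Q"
          unfolding PQ(1) by (rule pair_count_Un_square) (use PQ in auto)
        moreover have "cross_pairs g P = cross_pairs f P" by (rule pair_count_cong) (auto simp: gP)
        moreover have "pair_count (\<lambda>x y. g x \<noteq> g y) P Q = pair_count (\<lambda>_ _. True) P Q"
          by (rule pair_count_cong) (auto simp: gP gQ)
        moreover have "cross_pairs g Q = pair_count (\<lambda>_ _. False) Q Q" by (rule pair_count_cong) (auto simp: gQ)
        ultimately show ?thesis using PQ by (simp add: pair_count_True)
      qed
      \<comment> \<open>\<open>?X + ?Y\<close> is the sum of the degrees of the vertices of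
        \<open>Q\<close>. Outside \<open>B\<close> a degree is at most \<open>card P\<close> by the
        choice of \<open>x\<close>, and a vertex of \<open>B\<close> costs at most \<open>n\<close>.
        Both numbers enter the left side of the goal twice, \<open>?X\<close> in both orders and
        \<open>?Y\<close> as edges and as inner pairs, so the inner pairs are carried along at no
        cost.\<close>
      have 4: "real (?X + ?Y) \<le> real (card P) * real (card Q) + e / 4 * real n ^ 2"
      proof -
        have "?X = pair_count (adj E) Q P"
          by (subst pair_count_swap) (simp add: insert_commute)
        hence "?X + ?Y = pair_count (adj E) Q W"
          using PQ by (simp add: pair_count_Un_right)
        also have "\<dots> = (\<Sum>y\<in>Q. card (nbrs E W y))"
          using PQ W by (simp add: pair_count_sum nbrs_def)
        also have "\<dots> \<le> (\<Sum>y\<in>Q. card P + (if y \<in> B then n else 0))"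
        proof (rule sum_mono)
          fix y assume "y \<in> Q"
          hence "y \<in> W" by (simp add: Q_def)
          have "card (nbrs E W y) \<le> n" using W card_mono[OF W(2) nbrs_subset[of E W y]] by simp
          thus "card (nbrs E W y) \<le> card P + (if y \<in> B then n else 0)"
            using max[of y] \<open>y \<in> W\<close> by (auto simp: P_def)
        qed
        also have "\<dots> = card Q * card P + card (Q \<inter> B) * n"
          using PQ by (simp add: sum.distrib sum.If_cases)
        also have "\<dots> \<le> card Q * card P + card B * n"
          using B by (intro add_left_mono mult_right_mono card_mono) auto
        finally have "real (?X + ?Y) \<le> real (card Q * card P + card B * n)"
          by (simp only: of_nat_le_iff)
        thus ?thesis using cardBn by (simp add: mult.commute)
      qed
      show ?thesis using g
      proof (rule bexI[rotated])
        have "real (edge_pairs E W) + real (inner_pairs E g W) =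
          (real (edge_pairs E P) + real (inner_pairs E f P)) + 2 * real (?X + ?Y)"
          unfolding 1 2 by simp
        also have "\<dots> \<le> real (cross_pairs g W) + e * real n ^ 2"
          unfolding 3 using fle 4 by simp
        finally show "real (edge_pairs E W) + real (inner_pairs E g W) \<le> real (cross_pairs g W) + e * real n ^ 2" .
      qed
    qed
  qed
qed

section \<open>Turan numbers and transversal cliques\<close>

abbreviation missing_pairs :: "'a set set \<Rightarrow> ('a \<Rightarrow> nat) \<Rightarrow> 'a set \<Rightarrow> nat" where
  "missing_pairs E f W \<equiv> pair_count (\<lambda>x y. f x \<noteq> f y \<and> \<not> adj E x y) W W"

text \<open>Twice the Turan number: ordered pairs avoid halving.\<close>

definition turan_pairs :: "nat \<Rightarrow> nat \<Rightarrow> int" where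
  "turan_pairs k n = int n ^ 2 - (2 * int (n div k) + 1) * int n + int k * int (n div k) * (int (n div k) + 1)"

lemma sum_card_classes:
  fixes f :: "'a \<Rightarrow> nat"
  assumes "finite V" "f \<in> V \<rightarrow> {..<k}"
  shows "(\<Sum>i<k. card {x \<in> V. f x = i}) = card V"
proof -
  have "(\<Sum>i<k. card {x \<in> V. f x = i}) = card (\<Union>i<k. {x \<in> V. f x = i})"
    using assms(1) by (subst card_UN_disjoint) auto
  also have "(\<Union>i<k. {x \<in> V. f x = i}) = V" using assms(2) by auto
  finally show ?thesis .
qed

text \<open>With \<open>s i\<close> the class sizes and \<open>a = card V div k\<close>, expand
  \<open>(s i - a) * (s i - a - 1)\<close> and use that the \<open>s i\<close> sum to
  \<open>card V\<close>. A product of two consecutive integers is nonnegative and vanishes exactly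
  for the sizes \<open>a\<close> and \<open>a + 1\<close>, so the formula shows both that balanced
  partitions are optimal and what each deviating class costs.\<close>

lemma cross_pairs_eq:
  assumes "finite V" "f \<in> V \<rightarrow> {..<k}"
  shows "int (cross_pairs f V) = turan_pairs k (card V) -
    (\<Sum>i<k. (int (card {x \<in> V. f x = i}) - int (card V div k)) *
            (int (card {x \<in> V. f x = i}) - int (card V div k) - 1))"
proof -
  define s where "s i = int (card {x \<in> V. f x = i})" for i
  define a where "a = int (card V div k)"
  have sums: "(\<Sum>i<k. s i) = int (card V)"
    unfolding s_def using sum_card_classes[OF assms] by (metis of_nat_sum)
  have same: "int (pair_count (\<lambda>x y. f x = f y) V V) = (\<Sum>i<k. s i ^ 2)"
  proof -
    have "pair_count (\<lambda>x y. f x = f y) V V = (\<Sum>x\<in>V. card {y \<in> V. f x = f y})"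
      using assms by (simp add: pair_count_sum)
    also have "\<dots> = (\<Sum>i<k. \<Sum>x\<in>{x \<in> V. f x = i}. card {y \<in> V. f x = f y})"
      using assms by (subst sum.group) auto
    also have "\<dots> = (\<Sum>i<k. card {x \<in> V. f x = i} * card {x \<in> V. f x = i})"
    proof (rule sum.cong[OF refl])
      fix i
      have "(\<Sum>x\<in>{x \<in> V. f x = i}. card {y \<in> V. f x = f y}) = (\<Sum>x\<in>{x \<in> V. f x = i}. card {y \<in> V. f y = i})"
        by (rule sum.cong) (auto intro!: arg_cong[of _ _ card])
      thus "(\<Sum>x\<in>{x \<in> V. f x = i}. card {y \<in> V. f x = f y}) = card {x \<in> V. f x = i} * card {x \<in> V. f x = i}"
        by simp
    qed
    finally show ?thesis by (simp add: s_def power2_eq_square)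
  qed
  have "card V * card V = pair_count (\<lambda>x y. f x = f y) V V + cross_pairs f V"
    using pair_count_split[of V V "\<lambda>_ _. True" "\<lambda>x y. f x = f y"] assms by (simp add: pair_count_True)
  hence 1: "int (cross_pairs f V) = int (card V) ^ 2 - (\<Sum>i<k. s i ^ 2)"
    unfolding same[symmetric] by (simp add: power2_eq_square flip: of_nat_mult of_nat_add)
  have "(\<Sum>i<k. (s i - a) * (s i - a - 1)) = (\<Sum>i<k. s i ^ 2 - (2 * a + 1) * s i + a * (a + 1))"
    by (rule sum.cong) (auto simp: algebra_simps power2_eq_square)
  hence 2: "(\<Sum>i<k. (s i - a) * (s i - a - 1)) = (\<Sum>i<k. s i ^ 2) - (2 * a + 1) * int (card V) + int k * (a * (a + 1))"
    by (simp only: sum.distrib sum_subtractf sums sum_distrib_left[symmetric] sum_constant card_lessThan of_nat_id)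
      (simp only: distrib_left mult_1_right mult.left_commute mult.commute)
  have 3: "turan_pairs k (card V) = int (card V) ^ 2 - (2 * a + 1) * int (card V) + int k * (a * (a + 1))"
    unfolding turan_pairs_def a_def by (simp only: mult.assoc)
  have "int (cross_pairs f V) = turan_pairs k (card V) - (\<Sum>i<k. (s i - a) * (s i - a - 1))"
    unfolding 1 2 3 by (simp only: diff_diff_eq2 add_diff_cancel_right diff_add_eq diff_diff_eq add.commute diff_add_cancel)
  thus ?thesis unfolding s_def a_def .
qed

lemma consecutive_prod_nonneg: "(x :: int) * (x - 1) \<ge> 0"
proof (cases "x \<le> 0")
  case True
  thus ?thesis by (intro mult_nonpos_nonpos) auto
next
  case False
  thus ?thesis by (intro mult_nonneg_nonneg) auto
qed

lemma cross_pairs_le: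
  assumes "finite V" "f \<in> V \<rightarrow> {..<k}"
  shows "int (cross_pairs f V) \<le> turan_pairs k (card V)"
  unfolding cross_pairs_eq[OF assms] using sum_nonneg[where A = "{..<k}", OF consecutive_prod_nonneg] by (simp only: diff_le_eq le_add_same_cancel1)

lemma class_deviation_le:
  assumes "finite V" "f \<in> V \<rightarrow> {..<k}" "i < k"
  shows "(int (card {x \<in> V. f x = i}) - int (card V div k)) * (int (card {x \<in> V. f x = i}) - int (card V div k) - 1)
     \<le> turan_pairs k (card V) - int (cross_pairs f V)"
proof -
  let ?g = "\<lambda>i. (int (card {x \<in> V. f x = i}) - int (card V div k)) * (int (card {x \<in> V. f x = i}) - int (card V div k) - 1)"
  have "?g i \<le> (\<Sum>i<k. ?g i)"
    by (rule member_le_sum[OF _ consecutive_prod_nonneg]) (use assms(3) in simp_all)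
  thus ?thesis unfolding cross_pairs_eq[OF assms(1,2)] by (simp only: diff_diff_eq2 add_diff_cancel_left')
qed

text \<open>Adjacent cross pairs are common to both sides. For a graph with more than
  \<open>turan_pairs\<close> ordered edges it follows that \<open>missing_pairs\<close> is smaller
  than \<open>inner_pairs\<close>, and that \<open>cross_pairs\<close> falls short of the maximum by
  less than \<open>inner_pairs\<close>.\<close>

lemma edge_pairs_plus_missing:
  assumes "finite V"
  shows "edge_pairs E V + missing_pairs E f V = inner_pairs E f V + cross_pairs f V"
proof -
  have "edge_pairs E V = inner_pairs E f V + pair_count (\<lambda>x y. adj E x y \<and> f x \<noteq> f y) V V"
    using pair_count_split[of V V "adj E" "\<lambda>x y. f x = f y"] assms by simp
  moreover have "cross_pairs f V = pair_count (\<lambda>x y. f x \<noteq> f y \<and> adj E x y) V V + missing_pairs E f V"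
    using pair_count_split[of V V "\<lambda>x y. f x \<noteq> f y" "adj E"] assms by simp
  moreover have "pair_count (\<lambda>x y. f x \<noteq> f y \<and> adj E x y) V V = pair_count (\<lambda>x y. adj E x y \<and> f x \<noteq> f y) V V"
    by (rule pair_count_cong) auto
  ultimately show ?thesis by simp
qed

section \<open>Transversal cliques in a nearly complete multipartite graph\<close>

lemma card_nsets: "finite A \<Longrightarrow> card (nsets A k) = card A choose k"
proof -
  assume "finite A"
  hence "nsets A k = {B. B \<subseteq> A \<and> card B = k}" by (auto simp: nsets_def intro: finite_subset)
  thus ?thesis using \<open>finite A\<close> by (simp add: n_subsets)
qed

lemma card_nsets_le: "finite A \<Longrightarrow> card (nsets A k) \<le> card A ^ k"
  by (cases "k \<le> card A") (simp_all add: card_nsets binomial_le_pow binomial_eq_0)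

lemma card_nsets_through_pair:
  assumes "finite V" "y \<noteq> z"
  shows "card {S \<in> nsets V j. y \<in> S \<and> z \<in> S} \<le> card V ^ (j - 2)"
proof -
  have "card {S \<in> nsets V j. y \<in> S \<and> z \<in> S} \<le> card (nsets V (j - 2))"
  proof (rule card_inj_on_le[of "\<lambda>S. S - {y, z}"])
    show "inj_on (\<lambda>S. S - {y, z}) {S \<in> nsets V j. y \<in> S \<and> z \<in> S}"
      by (rule inj_onI) auto
    show "(\<lambda>S. S - {y, z}) ` {S \<in> nsets V j. y \<in> S \<and> z \<in> S} \<subseteq> nsets V (j - 2)"
      using assms(2) by (auto simp: nsets_def card_Diff_subset)
  qed (use assms in \<open>simp add: finite_imp_finite_nsets\<close>)
  also have "\<dots> \<le> card V ^ (j - 2)" by (rule card_nsets_le[OF assms(1)])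
  finally show ?thesis .
qed

text \<open>There are at least \<open>(a * n) ^ card J\<close> ways to choose one vertex from each
  \<open>N j\<close>, and each missing cross pair spoils at most \<open>n ^ (card J - 2)\<close> of
  them.\<close>

lemma transversal_cliques:
  assumes V: "finite V" "card V \<le> n" and J: "finite J"
    and N: "\<And>j. j \<in> J \<Longrightarrow> N j \<subseteq> {x \<in> V. f x = j}"
    and cardN: "\<And>j. j \<in> J \<Longrightarrow> real (card (N j)) \<ge> a * real n" and a: "a \<ge> 0"
    and miss: "real (missing_pairs E f V) \<le> e * real n ^ 2" and e: "e \<ge> 0"
  shows "real (card (cliques (card J) E (\<Union>j\<in>J. N j))) \<ge> (a ^ card J - e) * real n ^ card J"
proof -
  define T where "T = (\<lambda>g. g ` J) ` (PiE J N)"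
  have fN: "finite (N j)" if "j \<in> J" for j
    by (rule finite_subset[OF N[OF that]]) (use V in auto)
  have fg: "f (g j) = j" "g j \<in> V" "g j \<in> N j" if "g \<in> PiE J N" "j \<in> J" for g j
    using N[OF that(2)] that by auto
  \<comment> \<open>The colour \<open>f\<close> recovers the index of a chosen vertex, so the image
    set determines the choice.\<close>
  have "inj_on (\<lambda>g. g ` J) (PiE J N)"
  proof (rule inj_onI)
    fix g h assume gh: "g \<in> PiE J N" "h \<in> PiE J N" "g ` J = h ` J"
    show "g = h"
    proof (rule PiE_ext[OF gh(1,2)])
      fix j assume j: "j \<in> J"
      then obtain i where "i \<in> J" "g j = h i" using gh(3) by blast
      thus "g j = h j" using fg[OF gh(1) j] fg[OF gh(2)] by metis
    qed
  qed
  hence "card T = (\<Prod>j\<in>J. card (N j))" using J by (simp add: T_def card_image card_PiE)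
  moreover have "(\<Prod>j\<in>J. a * real n) \<le> (\<Prod>j\<in>J. real (card (N j)))"
    by (rule prod_mono) (use cardN a in auto)
  ultimately have cardT: "a ^ card J * real n ^ card J \<le> real (card T)"
    by (simp add: power_mult_distrib)
  have finT: "finite T" using J fN by (simp add: T_def finite_PiE)
  have T: "S \<in> nsets (\<Union>j\<in>J. N j) (card J)" "S \<in> nsets V (card J)" "inj_on f S" if "S \<in> T" for S
  proof -
    from that obtain g where g: "g \<in> PiE J N" "S = g ` J" by (auto simp: T_def)
    have "inj_on g J" by (rule inj_onI) (metis fg(1)[OF g(1)])
    hence "card S = card J" using g by (simp add: card_image)
    thus "S \<in> nsets (\<Union>j\<in>J. N j) (card J)" "S \<in> nsets V (card J)"
      using fg[OF g(1)] g J by (auto simp: nsets_def)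
    show "inj_on f S" unfolding g(2) by (rule inj_onI) (use fg[OF g(1)] in auto)
  qed
  let ?M = "{(y, z). y \<in> V \<and> z \<in> V \<and> f y \<noteq> f z \<and> \<not> adj E y z}"
  have finM: "finite ?M" using V by simp
  have bad: "T - cliques (card J) E (\<Union>j\<in>J. N j) \<subseteq> (\<Union>(y, z)\<in>?M. {S \<in> nsets V (card J). y \<in> S \<and> z \<in> S})"
  proof
    fix S assume S: "S \<in> T - cliques (card J) E (\<Union>j\<in>J. N j)"
    hence "\<not> nsets S 2 \<subseteq> E" using T by (auto simp: cliques_def)
    then obtain y z where yz: "y \<in> S" "z \<in> S" "y \<noteq> z" "{y, z} \<notin> E" by (auto simp: nsets_2_eq)
    have "f y \<noteq> f z" using T(3)[of S] S yz by (auto dest: inj_onD)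
    moreover have "y \<in> V" "z \<in> V" using T(2)[of S] S yz by (auto simp: nsets_def)
    ultimately show "S \<in> (\<Union>(y, z)\<in>?M. {S \<in> nsets V (card J). y \<in> S \<and> z \<in> S})"
      using S yz T(2) by auto
  qed
  have cardbad: "real (card (T - cliques (card J) E (\<Union>j\<in>J. N j))) \<le> e * real n ^ card J"
  \<comment> \<open>For fewer than two classes the truncated exponent \<open>card J - 2\<close>
    would lead to too high a power of \<open>n\<close>, but then there is no pair that could be
    missing.\<close>
  proof (cases "card J \<ge> 2")
    case True
    have "card (T - cliques (card J) E (\<Union>j\<in>J. N j)) \<le> card (\<Union>(y, z)\<in>?M. {S \<in> nsets V (card J). y \<in> S \<and> z \<in> S})"
      by (rule card_mono[OF _ bad]) (use V finM in \<open>auto simp: finite_imp_finite_nsets\<close>)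
    also have "\<dots> \<le> (\<Sum>(y, z)\<in>?M. card {S \<in> nsets V (card J). y \<in> S \<and> z \<in> S})"
      using card_UN_le[OF finM, of "\<lambda>(y, z). {S \<in> nsets V (card J). y \<in> S \<and> z \<in> S}"]
      by (simp add: case_prod_unfold)
    also have "\<dots> \<le> (\<Sum>(y, z)\<in>?M. n ^ (card J - 2))"
    proof (rule sum_mono, clarify)
      fix y z assume "f y \<noteq> f z"
      hence "card {S \<in> nsets V (card J). y \<in> S \<and> z \<in> S} \<le> card V ^ (card J - 2)"
        by (intro card_nsets_through_pair) (use V in auto)
      also have "\<dots> \<le> n ^ (card J - 2)" using V by (intro power_mono) auto
      finally show "card {S \<in> nsets V (card J). y \<in> S \<and> z \<in> S} \<le> n ^ (card J - 2)" .
    qed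
    also have "\<dots> = missing_pairs E f V * n ^ (card J - 2)" by (simp add: pair_count_def)
    finally have "real (card (T - cliques (card J) E (\<Union>j\<in>J. N j))) \<le> real (missing_pairs E f V * n ^ (card J - 2))"
      by (simp only: of_nat_le_iff)
    hence "real (card (T - cliques (card J) E (\<Union>j\<in>J. N j))) \<le> real (missing_pairs E f V) * real n ^ (card J - 2)"
      by simp
    also have "\<dots> \<le> e * real n ^ 2 * real n ^ (card J - 2)"
      using miss by (intro mult_right_mono) auto
    also have "\<dots> = e * real n ^ card J"
      using True by (simp only: mult.assoc power_add[symmetric] le_add_diff_inverse)
    finally show ?thesis .
  next
    case False
    have "T \<subseteq> cliques (card J) E (\<Union>j\<in>J. N j)"
    proof
      fix S assume S: "S \<in> T"
      have "nsets S 2 = {}" using T(1)[OF S] False by (intro nsets_eq_empty) (auto simp: nsets_def)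
      thus "S \<in> cliques (card J) E (\<Union>j\<in>J. N j)" using T(1)[OF S] by (simp add: cliques_def)
    qed
    hence "card (T - cliques (card J) E (\<Union>j\<in>J. N j)) = 0" by (simp only: Diff_eq_empty_iff[THEN iffD2] card.empty)
    thus ?thesis using e by simp
  qed
  have finC: "finite (cliques (card J) E (\<Union>j\<in>J. N j))" using J fN by (intro finite_cliques) auto
  have "card T \<le> card (T - cliques (card J) E (\<Union>j\<in>J. N j)) + card (cliques (card J) E (\<Union>j\<in>J. N j))"
    by (rule order_trans[OF card_mono card_Un_le]) (use finC finT in auto)
  thus ?thesis using cardT cardbad by (simp add: left_diff_distrib)
qed

section \<open>Many cliques above the Turan number\<close>

abbreviation colour_nbrs :: "'a set set \<Rightarrow> ('a \<Rightarrow> nat) \<Rightarrow> 'a set \<Rightarrow> 'a \<Rightarrow> nat \<Rightarrow> 'a set" where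
  "colour_nbrs E f V x j \<equiv> {y \<in> V. adj E x y \<and> f y = j}"

lemma inner_pairs_split_vertex:
  assumes "graph E" "finite V" "x \<in> V"
  shows "inner_pairs E f V = 2 * card (colour_nbrs E f V x (f x)) + inner_pairs E f (V - {x})"
proof -
  have V: "V = {x} \<union> (V - {x})" using assms(3) by auto
  have x: "{x} \<notin> E" using graph_no_loop[OF assms(1), of x x] by auto
  have "inner_pairs E f V = inner_pairs E f {x} +
      2 * pair_count (\<lambda>x y. adj E x y \<and> f x = f y) {x} (V - {x}) + inner_pairs E f (V - {x})"
    by (subst (1 2) V, rule pair_count_Un_square) (use assms in \<open>auto simp: insert_commute\<close>)
  moreover have "inner_pairs E f {x} = 0" using graph_no_loop[OF assms(1), of x] by (auto simp: pair_count_sum)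
  moreover have "pair_count (\<lambda>x y. adj E x y \<and> f x = f y) {x} (V - {x}) = card (colour_nbrs E f V x (f x))"
  proof -
    have "{y \<in> V - {x}. adj E x y \<and> f x = f y} = colour_nbrs E f V x (f x)"
    proof (rule Collect_cong)
      fix y
      have "adj E x y \<Longrightarrow> y \<noteq> x" using graph_no_loop[OF assms(1), of x y] by simp
      thus "(y \<in> V - {x} \<and> adj E x y \<and> f x = f y) = (y \<in> V \<and> adj E x y \<and> f y = f x)" by simp metis
    qed
    thus ?thesis using assms(2) by (simp add: pair_count_sum)
  qed
  ultimately show ?thesis by simp
qed

text \<open>Recolouring \<open>x\<close> with \<open>j\<close> changes only the pairs at
  \<open>x\<close>: twice the number of its neighbours of colour \<open>f x\<close> is replaced by
  twice the number of those of colour \<open>j\<close>.\<close>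

lemma min_inner_colour_nbrs:
  assumes "graph E" "finite V" "f \<in> V \<rightarrow> {..<k}" "x \<in> V" "j < k"
    and min: "\<And>g. g \<in> V \<rightarrow> {..<k} \<Longrightarrow> inner_pairs E f V \<le> inner_pairs E g V"
  shows "card (colour_nbrs E f V x (f x)) \<le> card (colour_nbrs E f V x j)"
proof (cases "j = f x")
  case False
  have x: "{x} \<notin> E" using graph_no_loop[OF assms(1), of x x] by auto
  let ?g = "f(x := j)"
  have "inner_pairs E ?g (V - {x}) = inner_pairs E f (V - {x})"
    by (rule pair_count_cong) auto
  moreover have "colour_nbrs E ?g V x j = colour_nbrs E f V x j" using x by auto
  moreover have "inner_pairs E f V \<le> inner_pairs E ?g V" by (rule min) (use assms in auto)
  ultimately show ?thesis
    using inner_pairs_split_vertex[OF assms(1,2,4), of f] inner_pairs_split_vertex[OF assms(1,2,4), of ?g] by simp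
qed simp

text \<open>Since \<open>n < (a + 1) * k \<le> 2 * a * k\<close>, the balanced size \<open>a\<close>
  exceeds \<open>n / (2 * k)\<close>. A class of less than half that value deviates by more than
  \<open>n / (4 * k)\<close>, whose square is the bound on \<open>D\<close>.\<close>

lemma class_size_lower_bound:
  fixes s a n k :: nat
  assumes k: "1 \<le> k" "k \<le> n" and a: "a = n div k"
    and dev: "(int s - int a) * (int s - int a - 1) \<le> D" and D: "real_of_int D \<le> real n ^ 2 / (16 * real k ^ 2)"
  shows "real s \<ge> real n / (4 * real k)"
proof (rule ccontr)
  assume "\<not> ?thesis"
  hence s: "real s < real n / (4 * real k)" by simp
  have "a \<ge> 1" using k a by (simp add: Suc_le_eq div_greater_zero_iff)
  have "n < (a + 1) * k" using k a by (simp add: dividend_less_div_times)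
  also have "\<dots> \<le> 2 * a * k" using \<open>a \<ge> 1\<close> by (intro mult_right_mono) auto
  finally have "real n < real (2 * a * k)" by (simp only: of_nat_less_iff)
  hence "real n / (2 * real k) < real a" using k by (simp add: field_simps)
  moreover have "real n / (2 * real k) = 2 * (real n / (4 * real k))" by simp
  ultimately have gap: "real a - real s > real n / (4 * real k)" using s by linarith
  have "(real n / (4 * real k))\<^sup>2 < (real a - real s) ^ 2"
    by (rule power_strict_mono[OF gap]) auto
  also have "\<dots> \<le> (real a - real s) * (real a - real s + 1)"
  proof -
    have "0 \<le> real n / (4 * real k)" by simp
    hence "real a - real s \<ge> 0" using gap by linarith
    thus ?thesis unfolding power2_eq_square by (intro mult_left_mono) auto
  qed
  also have "\<dots> = real_of_int ((int s - int a) * (int s - int a - 1))"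
    by (simp add: algebra_simps)
  also have "\<dots> \<le> real_of_int D" using dev by (simp only: of_int_le_iff)
  finally show False using D by (simp add: power_divide power_mult_distrib)
qed

lemma card_ge_threshold_mult_le:
  fixes m :: "'a \<Rightarrow> nat" and t :: real
  assumes "finite V"
  shows "real (card {x \<in> V. real (m x) \<ge> t}) * t \<le> real (\<Sum>x\<in>V. m x)"
  unfolding of_nat_sum by (rule card_mult_le_sum) (use assms in auto)

text \<open>
  Either many vertices have linear degree inside their own class, hence by minimality of \<open>f\<close> into
  every class, and each of them is in about \<open>n ^ k\<close> cliques; or most edges inside
  the classes have both ends joined to almost all of the other classes, and each of them is in
  about \<open>n ^ (k - 1)\<close> cliques.
\<close>

lemma near_turan_cliques:
  assumes k: "k \<ge> 2" and V: "finite V" "card V = n" "n \<ge> k" and E: "graph E"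
    and g: "g = 1 / (128 * real k)" and e: "e = g ^ k / 2"
    and f: "f \<in> V \<rightarrow> {..<k}" "\<And>h. h \<in> V \<rightarrow> {..<k} \<Longrightarrow> inner_pairs E f V \<le> inner_pairs E h V"
    and dense: "int (edge_pairs E V) > turan_pairs k n"
    and I: "real (inner_pairs E f V) \<le> e * real n ^ 2"
  shows "real (k + 1) * real (k + 2) * real (card (cliques (Suc k) E V)) \<ge>
         3 / 8 * e * real (inner_pairs E f V + missing_pairs E f V) * real n ^ (k - 1)"
proof -
  let ?I = "inner_pairs E f V" and ?M = "missing_pairs E f V"
  define c where "c = card (cliques (Suc k) E V)"
  have g0: "0 < g" "g \<le> 1" using k by (auto simp: g field_simps)
  have e0: "0 < e" using g0 by (simp add: e)
  have gpow: "g ^ k \<le> g ^ 2" using g0 k by (intro power_decreasing) auto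
  have cr: "int (cross_pairs f V) \<le> turan_pairs k n"
    using cross_pairs_le[OF V(1) f(1)] V by simp
  have MI: "edge_pairs E V + ?M = ?I + cross_pairs f V" by (rule edge_pairs_plus_missing[OF V(1)])
  have M: "?M < ?I" using MI cr dense by linarith
  have Me: "real ?M \<le> e * real n ^ 2" using M I by simp
  have sizes: "real (card {x \<in> V. f x = i}) \<ge> real n / (4 * real k)" if i: "i < k" for i
  proof (rule class_size_lower_bound)
    show "(int (card {x \<in> V. f x = i}) - int (n div k)) * (int (card {x \<in> V. f x = i}) - int (n div k) - 1)
        \<le> int ?I"
      using class_deviation_le[OF V(1) f(1) i, unfolded V(2)] MI dense by linarith
    \<comment> \<open>The class-size lemma tolerates a deviation of
      \<open>n ^ 2 / (16 * k ^ 2)\<close>; as \<open>k \<ge> 2\<close>, the bound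
      \<open>e * n ^ 2\<close> on the inner pairs is far below it.\<close>
    have "e \<le> g ^ 2 / 2" using gpow by (simp add: e)
    also have "\<dots> = (1 / (16 * real k ^ 2)) / 2048" by (simp add: g power_divide power_mult_distrib)
    also have "\<dots> \<le> 1 / (16 * real k ^ 2)" by (simp add: divide_le_eq)
    finally have "e \<le> 1 / (16 * real k ^ 2)" .
    hence "e * real n ^ 2 \<le> 1 / (16 * real k ^ 2) * real n ^ 2" by (intro mult_right_mono) auto
    thus "real_of_int (int ?I) \<le> real n ^ 2 / (16 * real k ^ 2)" using I by simp
  qed (use k V in auto)
  define din where "din x = card (colour_nbrs E f V x (f x))" for x
  define m where "m x = card {y \<in> V. f x \<noteq> f y \<and> \<not> adj E x y}" for x
  have summ: "(\<Sum>x\<in>V. m x) = ?M" using V by (simp add: pair_count_sum m_def)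
  define H where "H = {x \<in> V. real (din x) \<ge> g * real n}"
  have finH: "finite H" using V by (simp add: H_def)
  \<comment> \<open>Two demands meet here. Classes have at least \<open>32 * (g * n)\<close>
    vertices, so two vertices of one class below this threshold still share at least
    \<open>16 * (g * n)\<close> neighbours in every other class. And
    \<open>card U * (z * n) \<le> ?M < ?I\<close>, so \<open>U - H\<close>, whose vertices have
    inner degree below \<open>g * n\<close>, contains the first vertex of at most an eighth of the
    inner pairs.\<close>
  define z where "z = 8 * g"
  define U where "U = {x \<in> V. real (m x) \<ge> z * real n}"
  have finU: "finite U" using V by (simp add: U_def)

  have high: "real (card (cliques k E (nbrs E V x))) \<ge> e * real n ^ k" if x: "x \<in> H" for x
  proof -
    have xV: "x \<in> V" using x by (simp add: H_def)
    have "real (card (cliques (card {..<k}) E (\<Union>j\<in>{..<k}. colour_nbrs E f V x j))) \<ge> (g ^ card {..<k} - e) * real n ^ card {..<k}"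
    proof (rule transversal_cliques[OF V(1) _ _ _ _ _ Me])
      fix j assume j: "j \<in> {..<k}"
      have "din x \<le> card (colour_nbrs E f V x j)"
        unfolding din_def by (rule min_inner_colour_nbrs[OF E V(1) f(1) xV _ f(2)]) (use j in auto)
      thus "g * real n \<le> real (card (colour_nbrs E f V x j))" using x by (simp add: H_def)
    qed (use V e0 g0 in auto)
    moreover have "(\<Union>j\<in>{..<k}. colour_nbrs E f V x j) = nbrs E V x"
      using f(1) by (auto simp: nbrs_def)
    ultimately show ?thesis by (simp add: e)
  qed
  have good: "real (card (cliques (k - 1) E (nbrs E (nbrs E V u) v))) \<ge> e * real n ^ (k - 1)"
    if u: "u \<in> V - U" and v: "v \<in> V - U" and uv: "f u = f v" for u v
  proof -
    let ?J = "{..<k} - {f u}"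
    let ?N = "\<lambda>j. {y \<in> V. adj E u y \<and> adj E v y \<and> f y = j}"
    have "f u < k" using u f(1) by auto
    hence J: "card ?J = k - 1" by simp
    have "real (card (cliques (card ?J) E (\<Union>j\<in>?J. ?N j))) \<ge> (g ^ card ?J - e) * real n ^ card ?J"
    proof (rule transversal_cliques[OF V(1) _ _ _ _ _ Me])
      fix j assume j: "j \<in> ?J"
      have "{x \<in> V. f x = j} \<subseteq> ?N j \<union> ({y \<in> V. f u \<noteq> f y \<and> \<not> adj E u y} \<union> {y \<in> V. f v \<noteq> f y \<and> \<not> adj E v y})"
        using j uv by auto
      hence "card {x \<in> V. f x = j} \<le> card (?N j \<union> ({y \<in> V. f u \<noteq> f y \<and> \<not> adj E u y} \<union> {y \<in> V. f v \<noteq> f y \<and> \<not> adj E v y}))"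
        by (rule card_mono[rotated]) (use V in auto)
      also have "\<dots> \<le> card (?N j) + (m u + m v)"
        unfolding m_def by (intro order_trans[OF card_Un_le] add_left_mono card_Un_le)
      finally have "card {x \<in> V. f x = j} \<le> card (?N j) + (m u + m v)" .
      moreover have "real (m u) < z * real n" "real (m v) < z * real n" using u v by (auto simp: U_def)
      moreover have "real (card {x \<in> V. f x = j}) \<ge> real n / (4 * real k)" by (rule sizes) (use j in auto)
      moreover have "real n / (4 * real k) = 32 * (g * real n)" by (simp add: g)
      moreover have "g * real n \<ge> 0" using g0 by simp
      ultimately show "g * real n \<le> real (card (?N j))" unfolding z_def by linarith
    qed (use V e0 g0 in auto)
    moreover have "(g ^ card ?J - e) * real n ^ card ?J \<ge> e * real n ^ (k - 1)"
    proof -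
      have "g ^ k \<le> g ^ (k - 1)" using g0 k by (intro power_decreasing) auto
      thus ?thesis unfolding J e by (intro mult_right_mono) auto
    qed
    moreover have "card (cliques (card ?J) E (\<Union>j\<in>?J. ?N j)) \<le> card (cliques (k - 1) E (nbrs E (nbrs E V u) v))"
      unfolding J using V by (intro card_mono cliques_mono) (auto simp: nbrs_def)
    ultimately show ?thesis by linarith
  qed

  have H_le: "real (card H) * (e * real n ^ k) \<le> real (k + 1) * real c"
  proof -
    have "real (card H) * (e * real n ^ k) \<le> (\<Sum>x\<in>V. real (card (cliques k E (nbrs E V x))))"
      by (rule card_mult_le_sum) (use V high in \<open>auto simp: H_def\<close>)
    also have "\<dots> = real (\<Sum>x\<in>V. card (cliques k E (nbrs E V x)))" by simp
    also have "\<dots> = real (k + 1) * real c"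
      unfolding sum_card_cliques_nbrs[OF E V(1)] c_def by (simp add: algebra_simps)
    finally show ?thesis .
  qed
  define G where "G = pair_count (\<lambda>u v. (adj E u v \<and> f u = f v) \<and> u \<notin> U \<and> v \<notin> U) V V"
  \<comment> \<open>Each inner pair outside \<open>U\<close> is completed by a
    \<open>(k - 1)\<close>-clique in the common neighbourhood of its ends. Summing over
    \<open>v\<close> and then over \<open>u\<close> counts every \<open>(k + 1)\<close>-clique at
    most \<open>(k + 1) * k\<close> times.\<close>
  have G_le: "real G * (e * real n ^ (k - 1)) \<le> real (k + 1) * real k * real c"
  proof -
    have *: "real (card {v \<in> V. (adj E u v \<and> f u = f v) \<and> u \<notin> U \<and> v \<notin> U}) * (e * real n ^ (k - 1))
      \<le> real k * real (card (cliques k E (nbrs E V u)))" if u: "u \<in> V" for u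
    proof -
      have "real (card {v \<in> V. (adj E u v \<and> f u = f v) \<and> u \<notin> U \<and> v \<notin> U}) * (e * real n ^ (k - 1))
        \<le> (\<Sum>v\<in>nbrs E V u. real (card (cliques (k - 1) E (nbrs E (nbrs E V u) v))))"
        by (rule card_mult_le_sum) (use V good u in \<open>auto simp: nbrs_def\<close>)
      also have "\<dots> = real (\<Sum>v\<in>nbrs E V u. card (cliques (k - 1) E (nbrs E (nbrs E V u) v)))" by simp
      also have "\<dots> = real k * real (card (cliques k E (nbrs E V u)))"
        using k V by (subst sum_card_cliques_nbrs[OF E]) auto
      finally show ?thesis .
    qed
    have "real G * (e * real n ^ (k - 1)) =
      (\<Sum>u\<in>V. real (card {v \<in> V. (adj E u v \<and> f u = f v) \<and> u \<notin> U \<and> v \<notin> U}) * (e * real n ^ (k - 1)))"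
      using V by (simp add: G_def pair_count_sum sum_distrib_right)
    also have "\<dots> \<le> (\<Sum>u\<in>V. real k * real (card (cliques k E (nbrs E V u))))"
      by (rule sum_mono) (rule *)
    also have "\<dots> = real k * real (\<Sum>u\<in>V. card (cliques k E (nbrs E V u)))"
      by (simp add: sum_distrib_left)
    also have "\<dots> = real (k + 1) * real k * real c"
      unfolding sum_card_cliques_nbrs[OF E V(1)] c_def by (simp add: algebra_simps)
    finally show ?thesis .
  qed
  define W where "W = U - H"
  have finW: "finite W" using finU by (simp add: W_def)
  have W_le: "real (card W) * (g * real n) \<le> real ?I / 8"
  proof -
    have "real (card U) * (z * real n) \<le> real ?M"
      unfolding U_def summ[symmetric] by (rule card_ge_threshold_mult_le[OF V(1)])
    moreover have "card W \<le> card U" using finU by (auto simp: W_def intro: card_mono)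
    hence "real (card W) * (z * real n) \<le> real (card U) * (z * real n)"
      using g0 by (intro mult_right_mono) (auto simp: z_def)
    ultimately have "real (card W) * (z * real n) \<le> real ?M" by linarith
    moreover have "real (card W) * (z * real n) = 8 * (real (card W) * (g * real n))" by (simp add: z_def)
    ultimately show ?thesis using M by linarith
  qed
  have H_pairs: "pair_count (\<lambda>u v. (adj E u v \<and> f u = f v) \<and> u \<in> H) V V \<le> card H * n"
  proof -
    have "pair_count (\<lambda>u v. (adj E u v \<and> f u = f v) \<and> u \<in> H) V V = pair_count (\<lambda>u v. (adj E u v \<and> f u = f v)) H V"
      unfolding pair_count_def by (rule arg_cong[of _ _ card]) (auto simp: H_def)
    also have "\<dots> \<le> card H * card V" by (rule pair_count_le[OF finH V(1)])
    finally show ?thesis using V by simp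
  qed
  have W_pairs: "real (pair_count (\<lambda>u v. (adj E u v \<and> f u = f v) \<and> u \<in> W) V V) \<le> real ?I / 8"
  proof -
    have "pair_count (\<lambda>u v. (adj E u v \<and> f u = f v) \<and> u \<in> W) V V = pair_count (\<lambda>u v. (adj E u v \<and> f u = f v)) W V"
      unfolding pair_count_def by (rule arg_cong[of _ _ card]) (auto simp: W_def U_def)
    also have "\<dots> = (\<Sum>u\<in>W. din u)"
      unfolding pair_count_sum[OF finW V(1)] din_def
      by (intro sum.cong refl arg_cong[of _ _ card]) auto
    finally have "real (pair_count (\<lambda>u v. (adj E u v \<and> f u = f v) \<and> u \<in> W) V V) = (\<Sum>u\<in>W. real (din u))" by simp
    also have "\<dots> \<le> (\<Sum>u\<in>W. g * real n)"
      by (rule sum_mono) (auto simp: W_def U_def H_def)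
    also have "\<dots> \<le> real ?I / 8" using W_le by simp
    finally show ?thesis .
  qed
  \<comment> \<open>An inner pair is counted by \<open>G\<close> or has an end in \<open>U\<close>,
    hence in \<open>H\<close> or in \<open>W\<close>. The pairs meeting \<open>W\<close> make up at
    most a quarter of \<open>?I\<close> and are absorbed on the left, which gives the factor
    \<open>4 / 3\<close>.\<close>
  have I_le: "real ?I \<le> 4 / 3 * (real G + 2 * (real (card H) * real n))"
  proof -
    let ?P = "\<lambda>u v. adj E u v \<and> f u = f v"
    have swap: "pair_count (\<lambda>u v. ?P u v \<and> v \<in> S) V V = pair_count (\<lambda>u v. ?P u v \<and> u \<in> S) V V" for S
      by (subst pair_count_swap, rule pair_count_cong) (auto simp: insert_commute)
    have 1: "?I = pair_count (\<lambda>u v. ?P u v \<and> u \<in> S) V V + pair_count (\<lambda>u v. ?P u v \<and> u \<notin> S) V V" for S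
      by (rule pair_count_split[OF V(1,1)])
    have 2: "pair_count (\<lambda>u v. ?P u v \<and> u \<notin> U) V V \<le> G + pair_count (\<lambda>u v. ?P u v \<and> v \<in> U) V V"
    proof -
      have "pair_count (\<lambda>u v. ?P u v \<and> u \<notin> U) V V =
        pair_count (\<lambda>u v. (?P u v \<and> u \<notin> U) \<and> v \<in> U) V V + pair_count (\<lambda>u v. (?P u v \<and> u \<notin> U) \<and> v \<notin> U) V V"
        by (rule pair_count_split[OF V(1,1)])
      moreover have "pair_count (\<lambda>u v. (?P u v \<and> u \<notin> U) \<and> v \<notin> U) V V = G"
        unfolding G_def by (rule pair_count_cong) auto
      moreover have "pair_count (\<lambda>u v. (?P u v \<and> u \<notin> U) \<and> v \<in> U) V V \<le> pair_count (\<lambda>u v. ?P u v \<and> v \<in> U) V V"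
        by (rule pair_count_mono) (use V in auto)
      ultimately show ?thesis by linarith
    qed
    have 3: "pair_count (\<lambda>u v. ?P u v \<and> u \<in> U) V V \<le> pair_count (\<lambda>u v. ?P u v \<and> u \<in> H) V V + pair_count (\<lambda>u v. ?P u v \<and> u \<in> W) V V"
    proof -
      have "pair_count (\<lambda>u v. ?P u v \<and> u \<in> U) V V =
        pair_count (\<lambda>u v. (?P u v \<and> u \<in> U) \<and> u \<in> H) V V + pair_count (\<lambda>u v. (?P u v \<and> u \<in> U) \<and> u \<notin> H) V V"
        by (rule pair_count_split[OF V(1,1)])
      moreover have "pair_count (\<lambda>u v. (?P u v \<and> u \<in> U) \<and> u \<in> H) V V \<le> pair_count (\<lambda>u v. ?P u v \<and> u \<in> H) V V"
        by (rule pair_count_mono) (use V in auto)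
      moreover have "pair_count (\<lambda>u v. (?P u v \<and> u \<in> U) \<and> u \<notin> H) V V = pair_count (\<lambda>u v. ?P u v \<and> u \<in> W) V V"
        by (rule pair_count_cong) (auto simp: W_def)
      ultimately show ?thesis by linarith
    qed
    have "?I \<le> G + 2 * pair_count (\<lambda>u v. ?P u v \<and> u \<in> U) V V"
      using 1[of U] 2 unfolding swap by linarith
    also have "\<dots> \<le> G + 2 * (card H * n + pair_count (\<lambda>u v. ?P u v \<and> u \<in> W) V V)"
      by (intro add_left_mono mult_left_mono order_trans[OF 3] add_right_mono H_pairs) simp
    finally have "real ?I \<le> real (G + 2 * (card H * n + pair_count (\<lambda>u v. ?P u v \<and> u \<in> W) V V))"
      by (simp only: of_nat_le_iff)
    hence "real ?I \<le> real G + 2 * (real (card H) * real n) + 2 * real (pair_count (\<lambda>u v. ?P u v \<and> u \<in> W) V V)"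
      by simp
    moreover have "b \<le> 4 / 3 * (g + 2 * h)" if "b \<le> g + 2 * h + 2 * w" "w \<le> b / 8" for b g h w :: real
      using that by simp
    ultimately show ?thesis using W_pairs by blast
  qed
  have pk: "real n ^ k = real n * real n ^ (k - 1)" using k by (cases k) auto
  \<comment> \<open>Missing pairs are fewer than inner pairs, so the sum is replaced by
    \<open>2 * ?I\<close>; the factor \<open>3 / 8\<close> then cancels against
    \<open>2 * (4 / 3)\<close>.\<close>
  have "3 / 8 * e * real (?I + ?M) * real n ^ (k - 1) \<le> 3 / 8 * e * (2 * real ?I) * real n ^ (k - 1)"
    using M e0 by (intro mult_right_mono mult_left_mono) auto
  also have "\<dots> \<le> 3 / 8 * e * (2 * (4 / 3 * (real G + 2 * (real (card H) * real n)))) * real n ^ (k - 1)"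
    using I_le e0 by (intro mult_right_mono mult_left_mono) auto
  also have "\<dots> = real G * (e * real n ^ (k - 1)) + 2 * (real (card H) * (e * real n ^ k))"
    unfolding pk by (simp add: algebra_simps)
  also have "\<dots> \<le> real (k + 1) * real k * real c + 2 * (real (k + 1) * real c)"
    using G_le H_le by linarith
  also have "\<dots> = real (k + 1) * real (k + 2) * real c" by (simp add: algebra_simps)
  finally show ?thesis by (simp add: c_def)
qed

lemma le_divide_rearrange:
  fixes P :: real
  assumes "P > 0" "a * x * y \<le> P * z"
  shows "a / P * x * y \<le> z"
  using assms by (simp add: pos_divide_le_eq mult.commute)

text \<open>With more than \<open>d * n ^ (k + 1)\<close> cliques a constant colouring does, as at
  most \<open>2 * n ^ 2\<close> pairs are counted on the right. Otherwise \<open>stability\<close>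
  gives a colouring; its cross pairs do not exceed the edges, so it has at most
  \<open>e * n ^ 2\<close> inner pairs. A colouring with the fewest inner pairs then meets the
  hypotheses of \<open>near_turan_cliques\<close>.\<close>

lemma many_cliques:
  assumes k: "k \<ge> 2"
  shows "\<exists>c>0. \<forall>(V :: 'a set) E. finite V \<longrightarrow> card V \<ge> k \<longrightarrow> graph E \<longrightarrow>
    int (edge_pairs E V) > turan_pairs k (card V) \<longrightarrow>
    (\<exists>f \<in> V \<rightarrow> {..<k}. real (card (cliques (Suc k) E V)) \<ge>
        c * real (inner_pairs E f V + missing_pairs E f V) * real (card V) ^ (k - 1))"
proof -
  define g where "g = 1 / (128 * real k)"
  define e where "e = g ^ k / 2"
  have e0: "e > 0" using k by (simp add: e_def g_def)
  obtain d where d: "d > 0" and st: "\<And>n (V :: 'a set) E. graph E \<Longrightarrow> finite V \<Longrightarrow> card V \<le> n \<Longrightarrow>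
           real (card (cliques (Suc k) E V)) \<le> d * real n ^ Suc k \<Longrightarrow>
           (\<exists>f \<in> V \<rightarrow> {..<k}. real (edge_pairs E V) + real (inner_pairs E f V)
                 \<le> real (cross_pairs f V) + e * real n ^ 2)"
    using stability[of k e, where ?'a = 'a] k e0 by auto
  define q where "q = 3 / 8 * e / (real (k + 1) * real (k + 2))"
  define c where "c = min (d / 2) q"
  have c: "c \<le> d / 2" "c \<le> q" "c > 0" using d e0 by (auto simp: c_def q_def)
  show ?thesis
  proof (intro exI[of _ c] conjI allI impI)
    show "c > 0" by (rule c)
    fix V :: "'a set" and E
    assume V: "finite V" "card V \<ge> k" and E: "graph E" and dense: "int (edge_pairs E V) > turan_pairs k (card V)"
    define n where "n = card V"
    show "\<exists>f \<in> V \<rightarrow> {..<k}. real (card (cliques (Suc k) E V)) \<ge>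
        c * real (inner_pairs E f V + missing_pairs E f V) * real (card V) ^ (k - 1)"
    proof (cases "real (card (cliques (Suc k) E V)) \<le> d * real n ^ Suc k")
      case False
      let ?f = "\<lambda>_ :: 'a. 0 :: nat"
      have "inner_pairs E ?f V \<le> n * n" "missing_pairs E ?f V \<le> n * n"
        unfolding n_def by (rule pair_count_le[OF V(1,1)])+
      hence "real (inner_pairs E ?f V + missing_pairs E ?f V) \<le> real (2 * (n * n))"
        unfolding of_nat_le_iff by linarith
      hence "c * real (inner_pairs E ?f V + missing_pairs E ?f V) * real n ^ (k - 1) \<le> d / 2 * real (2 * (n * n)) * real n ^ (k - 1)"
        using c d by (intro mult_right_mono mult_mono) auto
      also have "\<dots> = d * real n ^ Suc k"
        using k by (cases k) auto
      finally show ?thesis using False k unfolding n_def by (intro bexI[of _ ?f]) auto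
    next
      case True
      from st[OF E V(1) _ True] obtain f0 where f0: "f0 \<in> V \<rightarrow> {..<k}"
        "real (edge_pairs E V) + real (inner_pairs E f0 V) \<le> real (cross_pairs f0 V) + e * real n ^ 2"
        unfolding n_def by auto
      obtain f where f: "f \<in> V \<rightarrow> {..<k}" and min: "\<And>h. h \<in> V \<rightarrow> {..<k} \<Longrightarrow> inner_pairs E f V \<le> inner_pairs E h V"
        using ex_has_least_nat[of "\<lambda>f. f \<in> V \<rightarrow> {..<k}" f0 "\<lambda>f. inner_pairs E f V"] f0(1) by blast
      have "int (cross_pairs f0 V) \<le> turan_pairs k (card V)" by (rule cross_pairs_le[OF V(1) f0(1)])
      hence "real (cross_pairs f0 V) \<le> real (edge_pairs E V)" using dense by linarith
      hence "real (inner_pairs E f0 V) \<le> e * real n ^ 2" using f0(2) by linarith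
      hence I: "real (inner_pairs E f V) \<le> e * real n ^ 2" using min[OF f0(1)] by linarith
      have "3 / 8 * e * real (inner_pairs E f V + missing_pairs E f V) * real n ^ (k - 1)
        \<le> real (k + 1) * real (k + 2) * real (card (cliques (Suc k) E V))"
        by (rule near_turan_cliques[OF k V(1) _ _ E g_def e_def f min _ I])
          (use V dense in \<open>auto simp: n_def\<close>)
      hence "q * real (inner_pairs E f V + missing_pairs E f V) * real n ^ (k - 1) \<le> real (card (cliques (Suc k) E V))"
        unfolding q_def by (rule le_divide_rearrange[rotated]) simp
      moreover have "c * real (inner_pairs E f V + missing_pairs E f V) * real n ^ (k - 1)
         \<le> q * real (inner_pairs E f V + missing_pairs E f V) * real n ^ (k - 1)"
        using c by (intro mult_right_mono) auto
      ultimately show ?thesis using f unfolding n_def by (intro bexI[of _ f]) auto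
    qed
  qed
qed

section \<open>Detection\<close>

lemma pair_count_adj:
  assumes "finite V" "E \<subseteq> nsets V 2"
  shows "edge_pairs E V = 2 * card E"
proof -
  let ?P = "{(x, y). x \<in> V \<and> y \<in> V \<and> adj E x y}"
  let ?h = "\<lambda>(x, y). {x, y}"
  have finE: "finite E" using assms finite_imp_finite_nsets finite_subset by metis
  have "(\<Sum>p\<in>?P. 1 :: nat) = (\<Sum>e\<in>E. \<Sum>p\<in>{p \<in> ?P. ?h p = e}. 1)"
    by (rule sum.group[symmetric]) (use assms finE in auto)
  also have "\<dots> = (\<Sum>e\<in>E. 2)"
  proof (rule sum.cong[OF refl])
    fix e assume e: "e \<in> E"
    then obtain a b where ab: "e = {a, b}" "a \<noteq> b" "a \<in> V" "b \<in> V"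
      using assms(2) by (meson nsets2_E subsetD)
    have "{p \<in> ?P. ?h p = e} = {(a, b), (b, a)}"
      using ab e by (auto simp: doubleton_eq_iff insert_commute)
    thus "(\<Sum>p\<in>{p \<in> ?P. ?h p = e}. 1 :: nat) = 2" using ab(2) by simp
  qed
  finally show ?thesis unfolding pair_count_def by simp
qed

lemma pair_count_bij:
  assumes "bij_betw s A B"
  shows "pair_count (\<lambda>x y. P (s x) (s y)) A A = pair_count P B B"
proof -
  have "bij_betw (map_prod s s) {(x, y). x \<in> A \<and> y \<in> A \<and> P (s x) (s y)} {(x, y). x \<in> B \<and> y \<in> B \<and> P x y}"
    unfolding bij_betw_def
  proof
    show "inj_on (map_prod s s) {(x, y). x \<in> A \<and> y \<in> A \<and> P (s x) (s y)}"
      using assms by (auto simp: bij_betw_def inj_on_def)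
    have B: "B = s ` A" using assms by (simp add: bij_betw_def)
    show "map_prod s s ` {(x, y). x \<in> A \<and> y \<in> A \<and> P (s x) (s y)} = {(x, y). x \<in> B \<and> y \<in> B \<and> P x y}"
      unfolding B by (auto simp: image_iff)
  qed
  thus ?thesis unfolding pair_count_def by (rule bij_betw_same_card)
qed

section \<open>Complete multipartite graphs, Turan numbers and edit distance\<close>

definition multipartite :: "('a \<Rightarrow> nat) \<Rightarrow> 'a set \<Rightarrow> 'a set set" where
  "multipartite f V = {{x, y} |x y. x \<in> V \<and> y \<in> V \<and> f x \<noteq> f y}"

lemma multipartite_subset: "multipartite f V \<subseteq> nsets V 2"
  by (auto simp: multipartite_def)

lemma adj_multipartite: "adj (multipartite f V) x y \<longleftrightarrow> x \<in> V \<and> y \<in> V \<and> f x \<noteq> f y"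
  by (auto simp: multipartite_def doubleton_eq_iff)

lemma cross_pairs_card: "finite V \<Longrightarrow> cross_pairs f V = 2 * card (multipartite f V)"
proof -
  assume V: "finite V"
  have "cross_pairs f V = edge_pairs (multipartite f V) V"
    by (rule pair_count_cong) (simp add: adj_multipartite)
  thus ?thesis using pair_count_adj[OF V multipartite_subset] by simp
qed

lemma turan_graph_multipartite: "turan_graph r n = multipartite (\<lambda>x. x mod (r - 1)) {1..n}"
  by (simp add: turan_graph_def multipartite_def)

text \<open>Among the first \<open>a * k\<close> positive integers every residue occurs exactly
  \<open>a\<close> times, and \<open>n\<close> lies between two consecutive multiples of
  \<open>k\<close>.\<close>

lemma card_residue_class:
  assumes "k > 0" "i < k"
  shows "card {x \<in> {1..n}. x mod k = i} \<in> {n div k, n div k + 1}"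
proof -
  have div_eq: "(b + c * k) div k = c" if "b < k" for b c using that by simp
  have exact: "card {x \<in> {1..a * k}. x mod k = i} = a" for a
  proof -
    \<comment> \<open>The numbers start at 1, so in block \<open>q\<close> the residue 0 is
      represented by the last element \<open>q * k + k\<close>.\<close>
    have "bij_betw (\<lambda>q. q * k + (if i = 0 then k else i)) {..<a} {x \<in> {1..a * k}. x mod k = i}"
    proof (rule bij_betwI[where g = "\<lambda>x. (x - 1) div k"])
      show "(\<lambda>q. q * k + (if i = 0 then k else i)) \<in> {..<a} \<rightarrow> {x \<in> {1..a * k}. x mod k = i}"
      proof
        fix q assume "q \<in> {..<a}"
        hence "Suc q * k \<le> a * k" by (intro mult_right_mono) auto
        thus "q * k + (if i = 0 then k else i) \<in> {x \<in> {1..a * k}. x mod k = i}"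
          using assms by auto
      qed
      show "(\<lambda>x. (x - 1) div k) \<in> {x \<in> {1..a * k}. x mod k = i} \<rightarrow> {..<a}"
        by (auto intro!: less_mult_imp_div_less)
      show "(q * k + (if i = 0 then k else i) - 1) div k = q" for q
      proof -
        have "q * k + (if i = 0 then k else i) - 1 = ((if i = 0 then k else i) - 1) + q * k" using assms by auto
        moreover have "(if i = 0 then k else i) - 1 < k" using assms by auto
        ultimately show ?thesis by (simp only: div_eq)
      qed
      show "(x - 1) div k * k + (if i = 0 then k else i) = x" if x: "x \<in> {x \<in> {1..a * k}. x mod k = i}" for x
      proof (cases "i = 0")
        case True
        hence "k dvd x" using x by (simp add: mod_eq_0_iff_dvd)
        then obtain q where q: "x = q * k" by (metis dvdE mult.commute)
        then obtain q' where "q = Suc q'" using x by (cases q) auto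
        hence "x - 1 = (k - 1) + q' * k" using q assms by simp
        hence "(x - 1) div k = q'" using div_eq[of "k - 1" q'] assms by (metis diff_less zero_less_one)
        thus ?thesis using True q \<open>q = Suc q'\<close> by simp
      next
        case False
        have "x = x div k * k + i" using x by (metis (mono_tags, lifting) div_mult_mod_eq mem_Collect_eq)
        hence "x - 1 = (i - 1) + x div k * k" using False by simp
        hence "(x - 1) div k = x div k" using div_eq[of "i - 1"] assms by (metis less_imp_diff_less)
        thus ?thesis using False \<open>x = x div k * k + i\<close> by simp
      qed
    qed
    thus ?thesis using bij_betw_same_card by fastforce
  qed
  have mono: "card {x \<in> {1..a}. x mod k = i} \<le> card {x \<in> {1..b}. x mod k = i}" if "a \<le> b" for a b
    by (rule card_mono) (use that in auto)
  have "n div k * k \<le> n" by simp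
  note mono[OF this]
  moreover have "n \<le> (n div k + 1) * k"
    using assms by (simp add: dividend_less_div_times less_imp_le)
  note mono[OF this]
  ultimately show ?thesis unfolding exact by auto
qed

text \<open>The residue classes modulo \<open>r - 1\<close> have only the two sizes for which the
  terms of the sum in \<open>cross_pairs_eq\<close> vanish.\<close>

lemma turan_number_pairs:
  assumes "r \<ge> 2"
  shows "2 * int (turan_number r n) = turan_pairs (r - 1) n"
proof -
  let ?k = "r - 1" and ?f = "\<lambda>x. x mod (r - 1)"
  have f: "?f \<in> {1..n} \<rightarrow> {..<?k}" using assms by auto
  have *: "(int (card {x \<in> {1..n}. ?f x = i}) - int (n div ?k)) * (int (card {x \<in> {1..n}. ?f x = i}) - int (n div ?k) - 1) = 0"
    if "i < ?k" for i
    using card_residue_class[of ?k i n] that by auto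
  hence "int (cross_pairs ?f {1..n}) = turan_pairs ?k n"
    using cross_pairs_eq[OF finite_atLeastAtMost f] sum.neutral[of "{..<?k}", OF ballI, OF *]
    by (simp only: card_atLeastAtMost diff_Suc_1 lessThan_iff Suc_eq_plus1[symmetric] diff_zero)
  thus ?thesis by (simp add: cross_pairs_card turan_number_def turan_graph_multipartite)
qed

lemma card_multipartite_le_turan:
  assumes "r \<ge> 2" "finite V" "f \<in> V \<rightarrow> {..<r - 1}"
  shows "card (multipartite f V) \<le> turan_number r (card V)"
  using cross_pairs_le[OF assms(2,3)] turan_number_pairs[OF assms(1), of "card V"]
  by (simp add: cross_pairs_card[OF assms(2)])

lemma card_sym_diff_multipartite:
  assumes "finite V" "E \<subseteq> nsets V 2"
  shows "2 * card (sym_diff E (multipartite f V)) = inner_pairs E f V + missing_pairs E f V"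
proof -
  let ?D = "sym_diff E (multipartite f V)"
  have "?D \<subseteq> nsets V 2" using assms(2) multipartite_subset[of f V] by auto
  hence "2 * card ?D = edge_pairs ?D V" by (rule pair_count_adj[OF assms(1), symmetric])
  also have "\<dots> = pair_count (\<lambda>x y. adj ?D x y \<and> f x = f y) V V + pair_count (\<lambda>x y. adj ?D x y \<and> f x \<noteq> f y) V V"
    by (rule pair_count_split[OF assms(1,1)])
  also have "pair_count (\<lambda>x y. adj ?D x y \<and> f x = f y) V V = inner_pairs E f V"
    by (rule pair_count_cong) (auto simp: adj_multipartite)
  also have "pair_count (\<lambda>x y. adj ?D x y \<and> f x \<noteq> f y) V V = missing_pairs E f V"
    by (rule pair_count_cong) (auto simp: adj_multipartite)
  finally show ?thesis .
qed

lemma detects_iff: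
  assumes "E \<subseteq> nsets V 2" "F \<subseteq> nsets V r"
  shows "detects r F E \<longleftrightarrow> F \<inter> cliques r E V \<noteq> {}"
proof -
  have "induces_complete r E S \<longleftrightarrow> S \<in> cliques r E V" if "S \<in> F" for S
  proof -
    have S: "S \<subseteq> V" "finite S" "card S = r" using assms(2) that by (auto simp: nsets_def)
    have "induced_edges E S \<subseteq> nsets S 2" using assms(1) S(2) by (auto simp: induced_edges_def nsets_def)
    moreover have "nsets S 2 \<subseteq> induced_edges E S \<longleftrightarrow> nsets S 2 \<subseteq> E" by (auto simp: induced_edges_def nsets_def)
    ultimately show ?thesis using S by (auto simp: induces_complete_def cliques_def nsets_def)
  qed
  thus ?thesis by (auto simp: detects_def)
qed

text \<open>Prepares the union bound: the ordered pairs of \<open>many_cliques\<close> become an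
  edit distance, and the colouring is made extensional, so that there are only
  \<open>(r - 1) ^ card V\<close> candidates.\<close>

lemma many_cliques_distance:
  assumes "r \<ge> 3"
  shows "\<exists>c>0. \<forall>(V :: 'a set) E. finite V \<longrightarrow> card V \<ge> r - 1 \<longrightarrow> E \<subseteq> nsets V 2 \<longrightarrow>
    card E > turan_number r (card V) \<longrightarrow>
    (\<exists>f \<in> V \<rightarrow>\<^sub>E {..<r - 1}. real (card (cliques r E V)) \<ge>
        c * real (card (sym_diff E (multipartite f V))) * real (card V) ^ (r - 2))"
proof -
  have "r - 1 \<ge> 2" using assms by simp
  from many_cliques[OF this, where ?'a = 'a]
  obtain c where c: "c > 0" and mc: "\<forall>(V :: 'a set) E. finite V \<longrightarrow> card V \<ge> r - 1 \<longrightarrow> graph E \<longrightarrow>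
    int (edge_pairs E V) > turan_pairs (r - 1) (card V) \<longrightarrow>
    (\<exists>f \<in> V \<rightarrow> {..<r - 1}. real (card (cliques (Suc (r - 1)) E V)) \<ge>
        c * real (inner_pairs E f V + missing_pairs E f V) * real (card V) ^ (r - 1 - 1))"
    by blast
  show ?thesis
  \<comment> \<open>Each changed pair was counted in both orders.\<close>
  proof (intro exI[of _ "2 * c"] conjI allI impI)
    show "2 * c > 0" using c by simp
    fix V :: "'a set" and E
    assume V: "finite V" "card V \<ge> r - 1" and E: "E \<subseteq> nsets V 2" "card E > turan_number r (card V)"
    have "graph E" using E(1) nsets_mono[of V UNIV 2] by (auto simp: graph_def)
    moreover have "int (edge_pairs E V) > turan_pairs (r - 1) (card V)"
      using E V turan_number_pairs[of r "card V"] assms by (simp add: pair_count_adj)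
    ultimately obtain f where f: "f \<in> V \<rightarrow> {..<r - 1}" and
      le: "real (card (cliques (Suc (r - 1)) E V)) \<ge>
        c * real (inner_pairs E f V + missing_pairs E f V) * real (card V) ^ (r - 1 - 1)"
      using mc V by blast
    have "multipartite (restrict f V) V = multipartite f V"
      unfolding multipartite_def by auto
    hence "real (inner_pairs E f V + missing_pairs E f V) = 2 * real (card (sym_diff E (multipartite (restrict f V) V)))"
      unfolding card_sym_diff_multipartite[OF V(1) E(1), symmetric] by simp
    moreover have "Suc (r - 1) = r" "r - 1 - 1 = r - 2" using assms by auto
    ultimately show "\<exists>f \<in> V \<rightarrow>\<^sub>E {..<r - 1}. real (card (cliques r E V)) \<ge>
        2 * c * real (card (sym_diff E (multipartite f V))) * real (card V) ^ (r - 2)"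
      using f le by (intro bexI[of _ "restrict f V"]) (auto simp: mult_ac)
  qed
qed

text \<open>Residue 1 comes first in \<open>{1..n}\<close>, so its class attains the size rounded
  up. For \<open>r = 3\<close> this rounding makes the codegree needed below at least half of
  \<open>n - 2\<close>.\<close>

lemma card_first_residue_class:
  assumes "k \<ge> 2"
  shows "card {x \<in> {1..n}. x mod k = 1} \<ge> (n + k - 1) div k"
proof -
  have "card {..<(n + k - 1) div k} \<le> card {x \<in> {1..n}. x mod k = 1}"
  proof (rule card_inj_on_le[of "\<lambda>q. q * k + 1"])
    show "inj_on (\<lambda>q. q * k + 1) {..<(n + k - 1) div k}" using assms by (auto simp: inj_on_def)
    show "(\<lambda>q. q * k + 1) ` {..<(n + k - 1) div k} \<subseteq> {x \<in> {1..n}. x mod k = 1}"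
    proof (rule image_subsetI)
      fix q assume "q \<in> {..<(n + k - 1) div k}"
      hence "Suc q \<le> (n + k - 1) div k" by simp
      hence "Suc q * k \<le> n + k - 1" using assms by (simp add: less_eq_div_iff_mult_less_eq)
      hence "q * k + 1 \<le> n" using assms by simp
      moreover have "(q * k + 1) mod k = 1 mod k" by (rule mod_mult_self3)
      hence "(q * k + 1) mod k = 1" using assms by simp
      ultimately show "q * k + 1 \<in> {x \<in> {1..n}. x mod k = 1}" by simp
    qed
  qed simp
  thus ?thesis by simp
qed

lemma not_turannical_if_small_codegree:
  assumes r: "r \<ge> 3" and F: "F \<subseteq> nsets {1..n} r" and uv: "u \<in> {1..n}" "v \<in> {1..n}" "u \<noteq> v"
    and small: "card {S \<in> F. u \<in> S \<and> v \<in> S} + 2 \<le> (n + (r - 1) - 1) div (r - 1)"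
  shows "\<not> turannical r {1..n} F"
proof -
  define k where "k = r - 1"
  have k: "k \<ge> 2" using r by (simp add: k_def)
  let ?V = "{1..n}"
  let ?C = "{x \<in> ?V. x mod k = 1}"
  let ?Fuv = "{S \<in> F. u \<in> S \<and> v \<in> S}"
  have finF: "finite F" using F finite_imp_finite_nsets[of ?V r] finite_subset by blast
  have "\<forall>S\<in>?Fuv. \<exists>z. z \<in> S - {u, v}"
  proof
    fix S assume "S \<in> ?Fuv"
    hence S: "card S = r" "finite S" using F by (auto simp: nsets_def)
    show "\<exists>z. z \<in> S - {u, v}"
    proof (rule ccontr)
      assume "\<nexists>z. z \<in> S - {u, v}"
      hence "S \<subseteq> {u, v}" by auto
      hence "card S \<le> card {u, v}" by (intro card_mono) auto
      thus False using S r uv by simp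
    qed
  qed
  then obtain z where z: "\<And>S. S \<in> ?Fuv \<Longrightarrow> z S \<in> S - {u, v}" by metis
  define A where "A = {u, v} \<union> z ` ?Fuv"
  have "z ` ?Fuv \<subseteq> ?V" using z F by (fastforce simp: nsets_def)
  hence A: "A \<subseteq> ?V" "finite A" using uv finF by (auto simp: A_def)
  have "card A \<le> card {u, v} + card (z ` ?Fuv)" unfolding A_def by (rule card_Un_le)
  also have "\<dots> \<le> 2 + card ?Fuv" using uv card_image_le[of ?Fuv z] finF by simp
  also have "\<dots> \<le> (n + k - 1) div k" using small by (simp add: k_def)
  also have "\<dots> \<le> card ?C" by (rule card_first_residue_class[OF k])
  finally have "card A \<le> card ?C" .
  moreover have "card ?C \<le> card ?V" by (rule card_mono) auto
  ultimately obtain B where B: "A \<subseteq> B" "B \<subseteq> ?V" "card B = card ?C"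
    using exists_subset_between[of A "card ?C" ?V] A by auto
  have finB: "finite B" using B(2) finite_subset by blast
  obtain s1 where s1: "bij_betw s1 B ?C"
    using finite_same_card_bij[OF finB _ B(3)] by auto
  have "card (?V - ?C) = card ?V - card ?C" by (rule card_Diff_subset) auto
  moreover have "card (?V - B) = card ?V - card B" by (rule card_Diff_subset[OF finB B(2)])
  ultimately have "card (?V - B) = card (?V - ?C)" using B(3) by (simp only:)
  then obtain s2 where s2: "bij_betw s2 (?V - B) (?V - ?C)"
    using finite_same_card_bij[of "?V - B" "?V - ?C"] by auto
  \<comment> \<open>A permutation of the vertices that carries \<open>B\<close> onto the class of
    residue 1. Colouring \<open>x\<close> by \<open>s x mod k\<close> gives a copy of the Turan
    graph, hence exactly \<open>turan_number r n\<close> edges, with all of \<open>A\<close> in one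
    class.\<close>
  define s where "s x = (if x \<in> B then s1 x else s2 x)" for x
  have "bij_betw s (B \<union> (?V - B)) (?C \<union> (?V - ?C))"
  proof (rule bij_betw_combine)
    show "bij_betw s B ?C" using s1 by (rule bij_betw_cong[THEN iffD1, rotated]) (simp add: s_def)
    show "bij_betw s (?V - B) (?V - ?C)" using s2 by (rule bij_betw_cong[THEN iffD1, rotated]) (simp add: s_def)
  qed auto
  moreover have "B \<union> (?V - B) = ?V" "?C \<union> (?V - ?C) = ?V" using B by auto
  ultimately have s: "bij_betw s ?V ?V" by simp
  define f where "f x = s x mod k" for x
  have fA: "f x = 1" if "x \<in> A" for x
  proof -
    have "s1 x \<in> ?C" using s1 B(1) that by (auto simp: bij_betw_def)
    thus ?thesis using that B(1) by (auto simp: f_def s_def)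
  qed
  have "cross_pairs f ?V = cross_pairs (\<lambda>x. x mod k) ?V"
    unfolding f_def by (rule pair_count_bij[OF s, of "\<lambda>x y. x mod k \<noteq> y mod k"])
  hence cardM: "card (multipartite f ?V) = turan_number r n"
    by (simp add: cross_pairs_card turan_number_def turan_graph_multipartite k_def)
  define E where "E = insert {u, v} (multipartite f ?V)"
  have E: "E \<subseteq> nsets ?V 2" using multipartite_subset[of f ?V] uv by (auto simp: E_def)
  have finM: "finite (multipartite f ?V)"
    using multipartite_subset[of f ?V] finite_imp_finite_nsets[of ?V 2] finite_subset by blast
  have uvA: "u \<in> A" "v \<in> A" by (auto simp: A_def)
  hence "{u, v} \<notin> multipartite f ?V" using fA by (simp add: adj_multipartite)
  hence "card E > turan_number r (card ?V)" using finM cardM by (simp add: E_def)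
  moreover have "\<not> detects r F E"
  proof
    assume "detects r F E"
    then obtain S where S: "S \<in> F" "S \<in> cliques r E ?V" using detects_iff[OF E F] by auto
    have SV: "S \<subseteq> ?V" "finite S" "card S = r" and SE: "nsets S 2 \<subseteq> E" using S(2) by (auto simp: cliques_def nsets_def)
    show False
    \<comment> \<open>The added edge \<open>{u, v}\<close> is the only one inside a class. A
      hyperedge containing it has a further vertex \<open>z S\<close> in the same class, not joined
      to \<open>u\<close>; any other clique meets each of the \<open>r - 1\<close> classes at most
      once.\<close>
    proof (cases "u \<in> S \<and> v \<in> S")
      case True
      hence "S \<in> ?Fuv" using S by simp
      from z[OF this] have zS: "z S \<in> S" "z S \<noteq> u" "z S \<noteq> v" by auto
      have "z S \<in> A" using \<open>S \<in> ?Fuv\<close> by (auto simp: A_def)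
      have "{u, z S} \<in> nsets S 2" using zS True by simp
      hence "{u, z S} \<in> E" using SE by blast
      hence "adj (multipartite f ?V) u (z S)" using zS by (auto simp: E_def doubleton_eq_iff)
      thus False using fA[OF \<open>z S \<in> A\<close>] fA[OF uvA(1)] by (simp add: adj_multipartite)
    next
      case False
      have "inj_on f S"
      proof (rule inj_onI, rule ccontr)
        fix x y assume xy: "x \<in> S" "y \<in> S" "f x = f y" "x \<noteq> y"
        hence "{x, y} \<in> nsets S 2" by simp
        hence "{x, y} \<in> E" using SE by blast
        moreover have "{x, y} \<noteq> {u, v}" using False xy by (auto simp: doubleton_eq_iff)
        ultimately show False using xy by (simp add: E_def adj_multipartite)
      qed
      hence "card S \<le> card {..<k}"
        by (rule card_inj_on_le) (use k in \<open>auto simp: f_def\<close>)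
      thus False using SV r by (simp add: k_def)
    qed
  qed
  ultimately show ?thesis using E by (auto simp: turannical_def)
qed

lemma detects_near_bipartite:
  fixes V :: "'a set" and \<epsilon> :: real
  assumes V: "finite V" "card V = n" and f: "f \<in> V \<rightarrow> {..<2}"
    and E: "E \<subseteq> nsets V 2" "card E > turan_number 3 n"
    and near: "card (sym_diff E (multipartite f V)) < L"
    and F: "F \<subseteq> nsets V 3"
    and codeg: "\<And>u v. u \<in> V \<Longrightarrow> v \<in> V \<Longrightarrow> u \<noteq> v \<Longrightarrow>
      real (card {z \<in> V - {u, v}. {u, v, z} \<in> F}) \<ge> (1 / 2 + \<epsilon>) * real n - 2"
    and n: "\<epsilon> * real n \<ge> 4 * real L + 4"
  shows "detects 3 F E"
proof (rule ccontr)
  assume undetected: "\<not> detects 3 F E"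
  let ?D = "sym_diff E (multipartite f V)"
  have finE: "finite E" using E(1) V(1) finite_imp_finite_nsets finite_subset by metis
  have finM: "finite (multipartite f V)"
    using multipartite_subset[of f V] V(1) finite_imp_finite_nsets finite_subset by metis
  have M_le: "card (multipartite f V) \<le> turan_number 3 n"
    using card_multipartite_le_turan[of 3 V f] V f by simp
  have "\<not> E \<subseteq> multipartite f V"
    using card_mono[OF finM, of E] M_le E(2) by linarith
  then obtain d where d: "d \<in> E" "d \<notin> multipartite f V" by blast
  then obtain u v where duv: "d = {u, v}" "u \<in> V" "v \<in> V" "u \<noteq> v"
    using E(1) by (meson nsets2_E subsetD)
  have uv: "{u, v} \<in> E" "u \<in> V" "v \<in> V" "u \<noteq> v" "f u = f v"
    using d duv by (simp_all add: adj_multipartite)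
  define j where "j = 1 - f u"
  have fu: "f u < 2" using f uv by auto
  have j: "j < 2" "j \<noteq> f u" using fu unfolding j_def by presburger+
  have "card E \<le> card (multipartite f V) + card ?D"
    by (rule order_trans[OF card_mono card_Un_le]) (use finE finM in auto)
  hence "turan_number 3 n < card (multipartite f V) + L" using E(2) near by linarith
  hence "turan_pairs 2 n - int (cross_pairs f V) < 2 * int L"
    using turan_number_pairs[of 3 n] by (simp add: cross_pairs_card[OF V(1)])
  moreover define x where "x = int (card {y \<in> V. f y = j}) - int (n div 2)"
  moreover have "x * (x - 1) \<le> turan_pairs 2 n - int (cross_pairs f V)"
    using class_deviation_le[OF V(1) f j(1)] V(2) by (simp add: x_def)
  ultimately have xx: "x * (x - 1) < 2 * int L" by linarith
  \<comment> \<open>For nonpositive \<open>x\<close> the factor \<open>1 - x\<close> is at least 1,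
    so the product bounds the deficit of the class linearly; only some constant bound is
    needed.\<close>
  have "x > - 2 * int L"
  proof (rule ccontr)
    assume "\<not> x > - 2 * int L"
    hence "2 * int L * 1 \<le> (- x) * (1 - x)" by (intro mult_mono) auto
    thus False using xx by (simp add: algebra_simps)
  qed
  \<comment> \<open>The extra \<open>1 / 2\<close> is the rounding in
    \<open>n div 2\<close>.\<close>
  hence cj: "real (card {y \<in> V. f y = j}) \<ge> real n / 2 - 1 / 2 - 2 * real L"
    unfolding x_def by linarith
  let ?Z = "{z \<in> V - {u, v}. {u, v, z} \<in> F}"
  have "?Z \<subseteq> (?Z \<inter> {y \<in> V. f y = j}) \<union> (V - {y \<in> V. f y = j})" by auto
  hence "card ?Z \<le> card ((?Z \<inter> {y \<in> V. f y = j}) \<union> (V - {y \<in> V. f y = j}))"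
    by (intro card_mono) (use V in auto)
  also have "\<dots> \<le> card (?Z \<inter> {y \<in> V. f y = j}) + card (V - {y \<in> V. f y = j})" by (rule card_Un_le)
  also have "card (V - {y \<in> V. f y = j}) = n - card {y \<in> V. f y = j}"
    using V by (subst card_Diff_subset) auto
  finally have "card ?Z \<le> card (?Z \<inter> {y \<in> V. f y = j}) + (n - card {y \<in> V. f y = j})" .
  moreover have "card {y \<in> V. f y = j} \<le> n" using V card_mono[of V "{y \<in> V. f y = j}"] by simp
  ultimately have "card ?Z + card {y \<in> V. f y = j} \<le> card (?Z \<inter> {y \<in> V. f y = j}) + n" by linarith
  hence "real (card ?Z) + real (card {y \<in> V. f y = j}) \<le> real (card (?Z \<inter> {y \<in> V. f y = j})) + real n" by linarith
  moreover have "real (card ?Z) \<ge> real n / 2 + \<epsilon> * real n - 2"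
    using codeg[OF uv(2-4)] by (simp add: distrib_right)
  \<comment> \<open>Of the slack \<open>4 * L + 4\<close>, a part \<open>2 * L\<close> pays for the
    deficit of the class and \<open>2 + 1 / 2\<close> for the constant terms. More than
    \<open>2 * L\<close> remains, which exceeds the number of vertices \<open>z\<close> that the
    changed pairs at \<open>u\<close> and \<open>v\<close> can account for.\<close>
  ultimately have lower: "real (card (?Z \<inter> {y \<in> V. f y = j})) > 2 * real L"
    using cj n by linarith
  let ?N = "\<lambda>w. {z \<in> V. {w, z} \<in> ?D}"
  have card_N: "card (?N w) \<le> card ?D" for w
    by (rule card_inj_on_le[of "\<lambda>z. {w, z}"]) (use finE finM in \<open>auto simp: inj_on_def doubleton_eq_iff\<close>)
  have "?Z \<inter> {y \<in> V. f y = j} \<subseteq> ?N u \<union> ?N v"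
  proof
    fix z assume z: "z \<in> ?Z \<inter> {y \<in> V. f y = j}"
    have "{u, v, z} \<notin> cliques 3 E V" using undetected detects_iff[OF E(1) F] z by auto
    moreover have "{u, v, z} \<in> nsets V 3" using z F by auto
    ultimately have "\<not> nsets {u, v, z} 2 \<subseteq> E" by (simp add: cliques_def)
    moreover have "nsets {u, v, z} 2 \<subseteq> {{u, v}, {u, z}, {v, z}}" by (auto simp: nsets_2_eq insert_commute)
    ultimately have "{u, z} \<notin> E \<or> {v, z} \<notin> E" using uv(1) by auto
    moreover have "adj (multipartite f V) u z" "adj (multipartite f V) v z"
      using z uv j by (auto simp: adj_multipartite)
    ultimately show "z \<in> ?N u \<union> ?N v" using z by auto
  qed
  hence "card (?Z \<inter> {y \<in> V. f y = j}) \<le> card (?N u \<union> ?N v)" by (intro card_mono) (use V in auto)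
  also have "\<dots> \<le> card ?D + card ?D" by (intro order_trans[OF card_Un_le] add_mono card_N)
  finally show False using lower near by linarith
qed

section \<open>Binomial tails and random hypergraphs\<close>

lemma measure_binomial_pmf:
  assumes "p \<in> {0..1}"
  shows "measure_pmf.prob (binomial_pmf m p) {x. P x} =
    (\<Sum>x | x \<le> m \<and> P x. real (m choose x) * p ^ x * (1 - p) ^ (m - x))"
proof -
  have "measure_pmf.prob (binomial_pmf m p) {x. P x} = measure_pmf.prob (binomial_pmf m p) {x. x \<le> m \<and> P x}"
    by (rule measure_prob_cong_0) (use assms in \<open>auto simp: binomial_eq_0\<close>)
  also have "\<dots> = (\<Sum>x | x \<le> m \<and> P x. real (m choose x) * p ^ x * (1 - p) ^ (m - x))"
    using assms by (subst measure_measure_pmf_finite) auto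
  finally show ?thesis .
qed

lemma binomial_zero_le:
  assumes "p \<in> {0..1}"
  shows "measure_pmf.prob (binomial_pmf m p) {0} \<le> exp (- p * real m)"
proof -
  have "measure_pmf.prob (binomial_pmf m p) {0} = (1 - p) ^ m"
    using assms by (simp add: measure_pmf_single)
  also have "\<dots> \<le> exp (- p) ^ m"
    using assms exp_ge_add_one_self[of "- p"] by (intro power_mono) auto
  also have "\<dots> = exp (- p * real m)" by (simp add: exp_of_nat_mult[symmetric] mult.commute)
  finally show ?thesis .
qed

text \<open>Markov's inequality for \<open>2 ^ X\<close>, whose mean is \<open>(1 + p) ^ m\<close>.\<close>

lemma binomial_upper_tail:
  assumes "p \<in> {0..1}"
  shows "measure_pmf.prob (binomial_pmf m p) {x. s \<le> x} \<le> exp (p * real m) / 2 ^ s"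
proof -
  let ?w = "\<lambda>x. real (m choose x) * p ^ x * (1 - p) ^ (m - x)"
  have w: "?w x \<ge> 0" for x using assms by simp
  have "measure_pmf.prob (binomial_pmf m p) {x. s \<le> x} = (\<Sum>x | x \<le> m \<and> s \<le> x. ?w x)"
    by (rule measure_binomial_pmf[OF assms])
  also have "\<dots> \<le> (\<Sum>x | x \<le> m \<and> s \<le> x. ?w x * (2 ^ x / 2 ^ s))"
  proof (rule sum_mono)
    fix x assume "x \<in> {x. x \<le> m \<and> s \<le> x}"
    hence "(2 :: real) ^ s \<le> 2 ^ x" by (intro power_increasing) auto
    hence "1 \<le> (2 :: real) ^ x / 2 ^ s" by simp
    thus "?w x \<le> ?w x * (2 ^ x / 2 ^ s)" using w[of x] by (metis mult_left_mono mult.right_neutral)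
  qed
  also have "\<dots> \<le> (\<Sum>x\<le>m. ?w x * (2 ^ x / 2 ^ s))"
    by (rule sum_mono2) (use w in auto)
  also have "\<dots> = (\<Sum>x\<le>m. real (m choose x) * (2 * p) ^ x * (1 - p) ^ (m - x)) / 2 ^ s"
    unfolding sum_divide_distrib by (rule sum.cong) (auto simp: power_mult_distrib)
  also have "(\<Sum>x\<le>m. real (m choose x) * (2 * p) ^ x * (1 - p) ^ (m - x)) = (2 * p + (1 - p)) ^ m"
    by (rule binomial_ring[symmetric])
  also have "2 * p + (1 - p) = 1 + p" by simp
  also have "(1 + p) ^ m / 2 ^ s \<le> exp p ^ m / 2 ^ s"
    using assms exp_ge_add_one_self[of p] by (intro divide_right_mono power_mono) auto
  also have "\<dots> = exp (p * real m) / 2 ^ s" by (simp add: exp_of_nat_mult[symmetric] mult.commute)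
  finally show ?thesis .
qed

text \<open>By Pascal's rule the central coefficient is the sum of two distinct entries of the
  preceding row, whose total is \<open>2 ^ (2 * h - 1)\<close>.\<close>

lemma central_binomial_upper_bound:
  assumes "h \<ge> 1"
  shows "2 * ((2 * h) choose h) \<le> 4 ^ h"
proof -
  obtain g where g: "h = Suc g" using assms by (cases h) auto
  have "(2 * h) choose h = (\<Sum>k\<in>{g, Suc g}. Suc (2 * g) choose k)" by (simp add: g)
  also have "\<dots> \<le> (\<Sum>k\<le>Suc (2 * g). Suc (2 * g) choose k)" by (rule sum_mono2) auto
  also have "\<dots> = 2 ^ Suc (2 * g)" by (rule choose_row_sum)
  finally have "2 * ((2 * h) choose h) \<le> 2 * 2 ^ Suc (2 * g)" by simp
  also have "\<dots> = 4 ^ h" by (simp add: g power_mult)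
  finally show ?thesis .
qed

text \<open>Reflecting \<open>x\<close> to \<open>m - x\<close> shows that, as
  \<open>p \<le> 1 / 2\<close>, more than half of \<open>m\<close> is no likelier than less than
  half. Hence the probability is at most \<open>(1 + w) / 2\<close>, where \<open>w\<close> is the
  weight of the exact middle, and \<open>w \<le> 1 / 2\<close> by the central binomial bound. For
  \<open>m = 0\<close> the event would be certain.\<close>

lemma binomial_upper_half:
  assumes p: "0 \<le> p" "p \<le> 1 / 2" and m: "m \<ge> 1"
  shows "measure_pmf.prob (binomial_pmf m p) {x. m \<le> 2 * x} \<le> 3 / 4"
proof -
  let ?P = "\<lambda>A. measure_pmf.prob (binomial_pmf m p) A"
  let ?w = "\<lambda>x. real (m choose x) * p ^ x * (1 - p) ^ (m - x)"
  have p01: "p \<in> {0..1}" using p by auto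
  have gt: "?P {x. m < 2 * x} \<le> ?P {x. 2 * x < m}"
  proof -
    have "?P {x. m < 2 * x} = (\<Sum>x | x \<le> m \<and> m < 2 * x. ?w x)"
      by (rule measure_binomial_pmf[OF p01])
    also have "\<dots> \<le> (\<Sum>x | x \<le> m \<and> m < 2 * x. ?w (m - x))"
    proof (rule sum_mono)
      fix x assume x: "x \<in> {x. x \<le> m \<and> m < 2 * x}"
      define d where "d = 2 * x - m"
      have d: "x = (m - x) + d" using x by (auto simp: d_def)
      have "p ^ x * (1 - p) ^ (m - x) = p ^ (m - x) * (1 - p) ^ (m - x) * p ^ d"
        by (subst d) (simp add: power_add)
      also have "\<dots> \<le> p ^ (m - x) * (1 - p) ^ (m - x) * (1 - p) ^ d"
        using p by (intro mult_left_mono power_mono) auto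
      also have "\<dots> = p ^ (m - x) * (1 - p) ^ x"
        using d by (metis power_add mult.assoc)
      finally have "real (m choose x) * (p ^ x * (1 - p) ^ (m - x)) \<le> real (m choose x) * (p ^ (m - x) * (1 - p) ^ x)"
        by (intro mult_left_mono) auto
      moreover have "m choose (m - x) = m choose x" using x by (auto simp: binomial_symmetric[of x m])
      ultimately show "?w x \<le> ?w (m - x)" using x by (simp add: mult.assoc)
    qed
    also have "\<dots> = (\<Sum>x | x \<le> m \<and> 2 * x < m. ?w x)"
      by (rule sum.reindex_bij_witness[of _ "\<lambda>x. m - x" "\<lambda>x. m - x"]) auto
    also have "\<dots> = ?P {x. 2 * x < m}" by (rule measure_binomial_pmf[OF p01, symmetric])
    finally show ?thesis .
  qed
  have eq: "?P {x. 2 * x = m} \<le> 1 / 2"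
  proof (cases "even m")
    case False
    hence "{x. 2 * x = m} = {}" by auto
    thus ?thesis by simp
  next
    case True
    then obtain h where h: "m = 2 * h" by auto
    have "?P {x. 2 * x = m} = ?P {h}" by (rule arg_cong[of _ _ ?P]) (auto simp: h)
    also have "\<dots> = real ((2 * h) choose h) * (p * (1 - p)) ^ h"
      using p by (simp add: measure_pmf_single h power_mult_distrib mult.assoc)
    also have "\<dots> \<le> real ((2 * h) choose h) * (1 / 4) ^ h"
    proof -
      have "(p - 1 / 2) ^ 2 \<ge> 0" by simp
      hence "p * (1 - p) \<le> 1 / 4" by (simp add: power2_eq_square algebra_simps)
      thus ?thesis using p by (intro mult_left_mono power_mono) auto
    qed
    also have "\<dots> \<le> 1 / 2"
    proof -
      have "h \<ge> 1" using m h by auto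
      from central_binomial_upper_bound[OF this]
      have "real (2 * ((2 * h) choose h)) \<le> real (4 ^ h)" by (simp only: of_nat_le_iff)
      thus ?thesis by (simp add: power_divide field_simps)
    qed
    finally show ?thesis .
  qed
  have ge: "?P {x. m \<le> 2 * x} = ?P {x. 2 * x = m} + ?P {x. m < 2 * x}"
    by (subst measure_pmf.finite_measure_Union[symmetric]) (auto intro!: arg_cong[of _ _ ?P])
  have "?P {x. 2 * x < m} + ?P {x. m \<le> 2 * x} = ?P ({x. 2 * x < m} \<union> {x. m \<le> 2 * x})"
    by (subst measure_pmf.finite_measure_Union[symmetric]) auto
  also have "\<dots> \<le> 1" by simp
  finally show ?thesis using gt eq ge by linarith
qed

text \<open>Intersecting with the supports makes both sets countable, which reduces the claim to the
  product rule for countable sets.\<close>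

lemma prob_pair_pmf_Times:
  "measure_pmf.prob (pair_pmf M N) (A \<times> B) = measure_pmf.prob M A * measure_pmf.prob N B"
proof -
  have "measure_pmf.prob (pair_pmf M N) (A \<times> B) = measure_pmf.prob (pair_pmf M N) ((A \<inter> set_pmf M) \<times> (B \<inter> set_pmf N))"
    by (subst measure_Int_set_pmf[symmetric]) (auto intro!: arg_cong[of _ _ "measure_pmf.prob (pair_pmf M N)"])
  also have "\<dots> = measure_pmf.prob M (A \<inter> set_pmf M) * measure_pmf.prob N (B \<inter> set_pmf N)"
    by (rule measure_pmf_prob_product) (auto intro: countable_subset)
  finally show ?thesis by (simp add: measure_Int_set_pmf)
qed

lemma card_Pi_pmf_bernoulli:
  assumes "finite A" "T \<subseteq> A" "p \<in> {0..1}"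
  shows "map_pmf (\<lambda>f. card {x \<in> T. f x}) (Pi_pmf A False (\<lambda>_. bernoulli_pmf p)) = binomial_pmf (card T) p"
proof -
  have "binomial_pmf (card T) p = map_pmf (\<lambda>f. card {x \<in> T. f x}) (Pi_pmf T False (\<lambda>_. bernoulli_pmf p))"
    by (rule binomial_pmf_altdef') (use assms finite_subset in auto)
  also have "Pi_pmf T False (\<lambda>_. bernoulli_pmf p) =
    map_pmf (\<lambda>f x. if x \<in> T then f x else False) (Pi_pmf A False (\<lambda>_. bernoulli_pmf p))"
    by (rule Pi_pmf_subset[OF assms(1,2)])
  also have "map_pmf (\<lambda>f. card {x \<in> T. f x}) \<dots> = map_pmf (\<lambda>f. card {x \<in> T. f x}) (Pi_pmf A False (\<lambda>_. bernoulli_pmf p))"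
    unfolding pmf.map_comp by (intro map_pmf_cong refl) (auto intro!: arg_cong[of _ _ card])
  finally show ?thesis ..
qed

text \<open>Splitting off the last block turns the product distribution into a pair of independent
  parts and the event into a rectangle.\<close>

lemma prob_disjoint_counts:
  fixes m :: nat
  assumes "finite (\<Union>i<m. T i)" "disjoint_family_on T {..<m}" "p \<in> {0..1}"
  shows "measure_pmf.prob (Pi_pmf (\<Union>i<m. T i) False (\<lambda>_. bernoulli_pmf p)) {f. \<forall>i<m. s \<le> card {x \<in> T i. f x}} =
    (\<Prod>i<m. measure_pmf.prob (binomial_pmf (card (T i)) p) {x. s \<le> x})"
  using assms(1,2)
proof (induction m)
  case 0
  thus ?case by simp
next
  case (Suc m)
  let ?A = "\<Union>i<m. T i" and ?B = "T m"
  let ?Pi = "\<lambda>A. Pi_pmf A False (\<lambda>_. bernoulli_pmf p)"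
  define h where "h = (\<lambda>(f, g) x. if x \<in> ?A then f x else g x :: bool)"
  have fin: "finite ?A" "finite ?B" using Suc.prems(1) by (auto simp: lessThan_Suc)
  have disj: "T i \<inter> ?B = {}" if "i < m" for i
    using Suc.prems(2) that by (auto simp: disjoint_family_on_def)
  hence AB: "?A \<inter> ?B = {}" by auto
  have "(\<Union>i<Suc m. T i) = ?A \<union> ?B" by (auto simp: lessThan_Suc)
  hence Pi: "?Pi (\<Union>i<Suc m. T i) = map_pmf h (pair_pmf (?Pi ?A) (?Pi ?B))"
    using Pi_pmf_union[OF fin AB] by (simp only: h_def)
  have vimage: "h -` {f. \<forall>i<Suc m. s \<le> card {x \<in> T i. f x}} =
    {f. \<forall>i<m. s \<le> card {x \<in> T i. f x}} \<times> {g. s \<le> card {x \<in> ?B. g x}}"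
  proof -
    have 1: "{x \<in> T i. h (f, g) x} = {x \<in> T i. f x}" if "i < m" for i f g
      using that by (auto simp: h_def)
    have 2: "{x \<in> ?B. h (f, g) x} = {x \<in> ?B. g x}" for f g
      using AB by (auto simp: h_def)
    have "h (f, g) \<in> {f. \<forall>i<Suc m. s \<le> card {x \<in> T i. f x}} \<longleftrightarrow>
        (f, g) \<in> {f. \<forall>i<m. s \<le> card {x \<in> T i. f x}} \<times> {g. s \<le> card {x \<in> ?B. g x}}" for f g
      unfolding less_Suc_eq all_conj_distrib by (auto simp: 1 2)
    thus ?thesis by (intro set_eqI) (simp only: vimage_eq split_paired_all)
  qed
  have "measure_pmf.prob (?Pi (\<Union>i<Suc m. T i)) {f. \<forall>i<Suc m. s \<le> card {x \<in> T i. f x}} =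
    measure_pmf.prob (?Pi ?A) {f. \<forall>i<m. s \<le> card {x \<in> T i. f x}} *
    measure_pmf.prob (?Pi ?B) {g. s \<le> card {x \<in> ?B. g x}}"
    unfolding Pi measure_map_pmf vimage by (rule prob_pair_pmf_Times)
  moreover have "measure_pmf.prob (?Pi ?B) {g. s \<le> card {x \<in> ?B. g x}} =
    measure_pmf.prob (binomial_pmf (card (T m)) p) {x. s \<le> x}"
    unfolding card_Pi_pmf_bernoulli[OF fin(2) subset_refl assms(3), symmetric] by (simp add: vimage_def)
  moreover have "measure_pmf.prob (?Pi ?A) {f. \<forall>i<m. s \<le> card {x \<in> T i. f x}} =
    (\<Prod>i<m. measure_pmf.prob (binomial_pmf (card (T i)) p) {x. s \<le> x})"
    by (rule Suc.IH) (use Suc.prems in \<open>auto simp: disjoint_family_on_def\<close>)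
  ultimately show ?case by simp
qed

section \<open>Random hypergraphs and the union bound over partitions and changed pairs\<close>

lemma set_random_hypergraph: "F \<in> set_pmf (random_hypergraph r n p) \<Longrightarrow> F \<subseteq> nsets {1..n} r"
  by (auto simp: random_hypergraph_def)

lemma random_hypergraph_prob_mono:
  assumes "\<And>F. F \<subseteq> nsets {1..n} r \<Longrightarrow> P F \<Longrightarrow> Q F"
  shows "measure_pmf.prob (random_hypergraph r n p) {F. P F} \<le> measure_pmf.prob (random_hypergraph r n p) {F. Q F}"
  by (rule measure_pmf.finite_measure_mono_AE)
    (auto simp: AE_measure_pmf_iff intro!: assms dest: set_random_hypergraph)

lemma random_hypergraph_card:
  assumes "T \<subseteq> nsets {1..n} r" "p \<in> {0..1}"
  shows "measure_pmf.prob (random_hypergraph r n p) {F. P (card (F \<inter> T))} =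
    measure_pmf.prob (binomial_pmf (card T) p) {x. P x}"
proof -
  have "{S \<in> nsets {1..n} r. f S} \<inter> T = {x \<in> T. f x}" for f using assms(1) by auto
  thus ?thesis
    unfolding card_Pi_pmf_bernoulli[OF finite_imp_finite_nsets[OF finite_atLeastAtMost] assms, symmetric]
    by (simp add: random_hypergraph_def vimage_def)
qed

lemma random_hypergraph_avoids:
  assumes "T \<subseteq> nsets {1..n} r" "p \<in> {0..1}"
  shows "measure_pmf.prob (random_hypergraph r n p) {F. F \<inter> T = {}} \<le> exp (- p * real (card T))"
proof -
  have finT: "finite T" using assms(1) finite_imp_finite_nsets[of "{1..n}" r] finite_subset by blast
  have "measure_pmf.prob (random_hypergraph r n p) {F. F \<inter> T = {}} \<le>
     measure_pmf.prob (random_hypergraph r n p) {F. card (F \<inter> T) = 0}"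
    by (rule random_hypergraph_prob_mono) simp
  also have "\<dots> = measure_pmf.prob (binomial_pmf (card T) p) {0}"
    using random_hypergraph_card[OF assms, of "\<lambda>x. x = 0"] by simp
  also have "\<dots> \<le> exp (- p * real (card T))" by (rule binomial_zero_le[OF assms(2)])
  finally show ?thesis .
qed

lemma prob_turannical_compl:
  "prob_turannical r n p = 1 - measure_pmf.prob (random_hypergraph r n p) {F. \<not> turannical r {1..n} F}"
proof -
  have "{F. \<not> turannical r {1..n} F} = space (measure_pmf (random_hypergraph r n p)) - {F. turannical r {1..n} F}"
    by auto
  thus ?thesis unfolding prob_turannical_def by (simp only: measure_pmf.prob_compl sets_measure_pmf UNIV_I)
qed

lemma sum_Pow_power:
  fixes q :: real
  assumes "finite A"
  shows "(\<Sum>D\<in>Pow A. q ^ card D) = (1 + q) ^ card A"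
  using prod_add[OF assms, of "\<lambda>_. q" "\<lambda>_. 1"] by (simp add: add.commute)

text \<open>A union bound over a colouring \<open>f\<close> and a set \<open>D\<close> of changed
  pairs, from which the graph is recovered as a symmetric difference. With
  \<open>q = exp (- \<beta> * n)\<close> the cliques of such a graph are avoided with probability at
  most \<open>q ^ (2 * card D)\<close>; this is the purpose of the factor 2 in the assumption on
  \<open>\<beta>\<close>. One half is at most \<open>q ^ L\<close> and pays for the
  \<open>k ^ n\<close> colourings; the other half, summed over all \<open>D\<close>, gives
  \<open>(1 + q) ^ (n choose 2)\<close>.\<close>

lemma prob_far_undetected:
  fixes c p \<beta> :: real and r n L :: nat
  defines "V \<equiv> {1..n}" and "k \<equiv> r - 1"
  assumes r: "r \<ge> 3" and p: "p \<in> {0..1}" and c: "c > 0"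
    and many: "\<And>E. E \<subseteq> nsets V 2 \<Longrightarrow> card E > turan_number r n \<Longrightarrow>
      \<exists>f \<in> V \<rightarrow>\<^sub>E {..<k}. real (card (cliques r E V)) \<ge>
        c * real (card (sym_diff E (multipartite f V))) * real n ^ (r - 2)"
    and \<beta>: "\<beta> \<ge> 0" "2 * \<beta> * real n \<le> p * c * real n ^ (r - 2)" and L: "real L * \<beta> \<ge> ln (real k) + 1"
  shows "measure_pmf.prob (random_hypergraph r n p)
     {F. \<exists>E. E \<subseteq> nsets V 2 \<and> card E > turan_number r n \<and> F \<inter> cliques r E V = {} \<and>
        (\<forall>f \<in> V \<rightarrow>\<^sub>E {..<k}. L \<le> card (sym_diff E (multipartite f V)))}
     \<le> exp (- real n) * exp (real n ^ 2 * exp (- \<beta> * real n))"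
proof -
  define q where "q = exp (- \<beta> * real n)"
  have q: "q > 0" "q \<le> 1" using \<beta>(1) by (auto simp: q_def)
  let ?C = "\<lambda>(f, D). cliques r (sym_diff D (multipartite f V)) V"
  define Idx where "Idx = {(f, D). f \<in> V \<rightarrow>\<^sub>E {..<k} \<and> D \<subseteq> nsets V 2 \<and> L \<le> card D \<and>
      real (card (?C (f, D))) \<ge> c * real (card D) * real n ^ (r - 2)}"
  have finN: "finite (nsets V 2)" by (simp add: V_def finite_imp_finite_nsets)
  have finPi: "finite (V \<rightarrow>\<^sub>E {..<k})" by (rule finite_PiE) (auto simp: V_def)
  have Idx_sub: "Idx \<subseteq> (V \<rightarrow>\<^sub>E {..<k}) \<times> Pow (nsets V 2)" by (auto simp: Idx_def)
  hence finI: "finite Idx" by (rule finite_subset) (use finN finPi in auto)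
  let ?M = "random_hypergraph r n p"
  have "measure_pmf.prob ?M {F. \<exists>E. E \<subseteq> nsets V 2 \<and> card E > turan_number r n \<and> F \<inter> cliques r E V = {} \<and>
        (\<forall>f \<in> V \<rightarrow>\<^sub>E {..<k}. L \<le> card (sym_diff E (multipartite f V)))}
     \<le> measure_pmf.prob ?M (\<Union>i\<in>Idx. {F. F \<inter> ?C i = {}})"
  proof (rule measure_pmf.finite_measure_mono)
    show "{F. \<exists>E. E \<subseteq> nsets V 2 \<and> card E > turan_number r n \<and> F \<inter> cliques r E V = {} \<and>
        (\<forall>f \<in> V \<rightarrow>\<^sub>E {..<k}. L \<le> card (sym_diff E (multipartite f V)))} \<subseteq> (\<Union>i\<in>Idx. {F. F \<inter> ?C i = {}})"
    proof clarify
      fix F E assume E: "E \<subseteq> nsets V 2" "card E > turan_number r n" "F \<inter> cliques r E V = {}"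
        and far: "\<forall>f \<in> V \<rightarrow>\<^sub>E {..<k}. L \<le> card (sym_diff E (multipartite f V))"
      obtain f where f: "f \<in> V \<rightarrow>\<^sub>E {..<k}" "real (card (cliques r E V)) \<ge>
        c * real (card (sym_diff E (multipartite f V))) * real n ^ (r - 2)" using many[OF E(1,2)] by auto
      let ?D = "sym_diff E (multipartite f V)"
      have inv: "sym_diff ?D (multipartite f V) = E" by auto
      have "?D \<subseteq> nsets V 2" using E(1) multipartite_subset[of f V] by auto
      hence "(f, ?D) \<in> Idx" using f far unfolding Idx_def by (simp add: inv)
      moreover have "F \<inter> ?C (f, ?D) = {}" using E(3) by (simp add: inv)
      ultimately show "F \<in> (\<Union>i\<in>Idx. {F. F \<inter> ?C i = {}})" by blast
    qed
  qed simp
  also have "\<dots> \<le> (\<Sum>i\<in>Idx. measure_pmf.prob ?M {F. F \<inter> ?C i = {}})"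
    by (rule measure_pmf.finite_measure_subadditive_finite[OF finI]) simp
  also have "\<dots> \<le> (\<Sum>i\<in>Idx. q ^ L * q ^ card (snd i))"
  proof (rule sum_mono)
    fix i assume i: "i \<in> Idx"
    obtain f D where fD: "i = (f, D)" by (cases i)
    let ?K = "cliques r (sym_diff D (multipartite f V)) V"
    have D: "L \<le> card D" "real (card ?K) \<ge> c * real (card D) * real n ^ (r - 2)"
      using i fD by (auto simp: Idx_def)
    have "?K \<subseteq> nsets {1..n} r" by (auto simp: cliques_def V_def)
    hence "measure_pmf.prob ?M {F. F \<inter> ?K = {}} \<le> exp (- p * real (card ?K))"
      by (rule random_hypergraph_avoids[OF _ p])
    also have "\<dots> \<le> exp (- (2 * \<beta> * real n * real (card D)))"
    proof -
      have "2 * \<beta> * real n * real (card D) \<le> p * c * real n ^ (r - 2) * real (card D)"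
        using \<beta>(2) by (intro mult_right_mono) auto
      also have "\<dots> = p * (c * real (card D) * real n ^ (r - 2))" by simp
      also have "\<dots> \<le> p * real (card ?K)" using D(2) p by (intro mult_left_mono) auto
      finally show ?thesis by simp
    qed
    also have "\<dots> = q ^ card D * q ^ card D"
      by (simp add: q_def flip: exp_of_nat_mult exp_add)
    also have "\<dots> \<le> q ^ L * q ^ card D"
      using q D(1) by (intro mult_right_mono power_decreasing) auto
    finally show "measure_pmf.prob ?M {F. F \<inter> ?C i = {}} \<le> q ^ L * q ^ card (snd i)" by (simp add: fD)
  qed
  also have "\<dots> \<le> (\<Sum>i\<in>(V \<rightarrow>\<^sub>E {..<k}) \<times> Pow (nsets V 2). q ^ L * q ^ card (snd i))"
    by (rule sum_mono2[OF _ Idx_sub]) (use finN finPi q in auto)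
  also have "\<dots> = (\<Sum>f\<in>V \<rightarrow>\<^sub>E {..<k}. \<Sum>D\<in>Pow (nsets V 2). q ^ L * q ^ card D)"
    by (subst sum.cartesian_product) (simp add: case_prod_unfold)
  also have "\<dots> = real k ^ n * (q ^ L * (1 + q) ^ card (nsets V 2))"
    unfolding sum_distrib_left[symmetric] sum_Pow_power[OF finN] by (simp add: card_PiE V_def)
  also have "\<dots> = (real k ^ n * q ^ L) * (1 + q) ^ card (nsets V 2)" by simp
  also have "\<dots> \<le> exp (- real n) * exp (real n ^ 2 * q)"
  proof (rule mult_mono)
    have "real k > 0" using r by (simp add: k_def)
    hence "real k ^ n = exp (real n * ln (real k))" by (simp add: exp_of_nat_mult)
    moreover have "q ^ L = exp (- (real L * \<beta>) * real n)" by (simp add: q_def mult.assoc flip: exp_of_nat_mult)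
    ultimately have "real k ^ n * q ^ L = exp (real n * (ln (real k) - real L * \<beta>))"
      by (simp add: algebra_simps flip: exp_add)
    also have "\<dots> \<le> exp (real n * (- 1))"
      using L by (subst exp_le_cancel_iff, intro mult_left_mono) auto
    finally show "real k ^ n * q ^ L \<le> exp (- real n)" by simp
    have "(1 + q) ^ card (nsets V 2) \<le> exp q ^ card (nsets V 2)"
      using q exp_ge_add_one_self[of q] by (intro power_mono) auto
    also have "\<dots> = exp (real (card (nsets V 2)) * q)" by (rule exp_of_nat_mult[symmetric])
    also have "\<dots> \<le> exp (real n ^ 2 * q)"
    proof -
      have "card (nsets V 2) \<le> n ^ 2" using card_nsets_le[of V 2] by (simp add: V_def)
      hence "real (card (nsets V 2)) \<le> real n ^ 2" by (metis of_nat_le_iff of_nat_power)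
      thus ?thesis using q by simp
    qed
    finally show "(1 + q) ^ card (nsets V 2) \<le> exp (real n ^ 2 * q)" .
  qed (use q in auto)
  finally show ?thesis by (simp add: q_def)
qed

section \<open>The thresholds\<close>

lemma turannical_imp_large_codegree:
  assumes "r \<ge> 3" "F \<subseteq> nsets {1..n} r" "turannical r {1..n} F" "u \<in> {1..n}" "v \<in> {1..n}" "u \<noteq> v"
  shows "(n + (r - 1) - 1) div (r - 1) - 1 \<le> card (F \<inter> {S \<in> nsets {1..n} r. u \<in> S \<and> v \<in> S})"
proof -
  have "F \<inter> {S \<in> nsets {1..n} r. u \<in> S \<and> v \<in> S} = {S \<in> F. u \<in> S \<and> v \<in> S}" using assms(2) by auto
  thus ?thesis using not_turannical_if_small_codegree[OF assms(1,2,4-6)] assms(3) by force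
qed

text \<open>The events for the disjoint pairs \<open>{2i + 1, 2i + 2}\<close> are independent, since no triple contains two of them.\<close>

lemma prob_turannical_3_le:
  assumes p: "0 \<le> p" "p \<le> 1 / 2" and n: "n \<ge> 3"
  shows "prob_turannical 3 n p \<le> (3 / 4) ^ (n div 2)"
proof -
  let ?V = "{1..n}" and ?m = "n div 2" and ?s = "(n + 1) div 2 - 1"
  define T where "T i = {S \<in> nsets ?V 3. 2 * i + 1 \<in> S \<and> 2 * i + 2 \<in> S}" for i
  let ?Pi = "\<lambda>A. Pi_pmf A False (\<lambda>_. bernoulli_pmf p)"
  have p01: "p \<in> {0..1}" using p by auto
  have T_sub: "(\<Union>i<?m. T i) \<subseteq> nsets ?V 3" by (auto simp: T_def)
  have finN: "finite (nsets ?V 3)" by (simp add: finite_imp_finite_nsets)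
  have cardT: "card (T i) = n - 2" if i: "i < ?m" for i
  proof -
    let ?u = "2 * i + 1" and ?v = "2 * i + 2"
    have uv: "?u \<in> ?V" "?v \<in> ?V" using i by auto
    have "bij_betw (\<lambda>z. {?u, ?v, z}) (?V - {?u, ?v}) (T i)"
      unfolding bij_betw_def
    proof
      show "inj_on (\<lambda>z. {?u, ?v, z}) (?V - {?u, ?v})" by (auto simp: inj_on_def)
      show "(\<lambda>z. {?u, ?v, z}) ` (?V - {?u, ?v}) = T i"
      proof (intro set_eqI iffI)
        fix S assume "S \<in> (\<lambda>z. {?u, ?v, z}) ` (?V - {?u, ?v})"
        thus "S \<in> T i" using uv by (auto simp: T_def nsets_def)
      next
        fix S assume "S \<in> T i"
        hence S: "S \<subseteq> ?V" "finite S" "card S = 3" "?u \<in> S" "?v \<in> S" by (auto simp: T_def nsets_def)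
        have "card (S - {?u, ?v}) = 1" using S by (subst card_Diff_subset) auto
        then obtain z where z: "S - {?u, ?v} = {z}" by (auto simp: card_1_singleton_iff)
        hence "S = {?u, ?v, z}" "z \<in> ?V - {?u, ?v}" using S by blast+
        thus "S \<in> (\<lambda>z. {?u, ?v, z}) ` (?V - {?u, ?v})" by blast
      qed
    qed
    hence "card (T i) = card (?V - {?u, ?v})" by (simp add: bij_betw_same_card)
    also have "\<dots> = card ?V - card {?u, ?v}" by (rule card_Diff_subset) (use uv in auto)
    finally show ?thesis by simp
  qed
  have disj: "disjoint_family_on T {..<?m}"
    unfolding disjoint_family_on_def
  proof (intro ballI impI, rule ccontr)
    fix i j assume "i \<noteq> j" "T i \<inter> T j \<noteq> {}"
    then obtain S where S: "S \<in> T i" "S \<in> T j" by auto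
    have "{2 * i + 1, 2 * i + 2, 2 * j + 1, 2 * j + 2} \<subseteq> S" using S by (auto simp: T_def)
    moreover have "finite S" "card S = 3" using S by (auto simp: T_def nsets_def)
    ultimately have "card {2 * i + 1, 2 * i + 2, 2 * j + 1, 2 * j + 2} \<le> 3" by (metis card_mono)
    moreover have "2 * i + 1 \<noteq> 2 * j + 2" "2 * i + 2 \<noteq> 2 * j + 1" by presburger+
    ultimately show False using \<open>i \<noteq> j\<close> by simp
  qed
  have "prob_turannical 3 n p \<le> measure_pmf.prob (random_hypergraph 3 n p) {F. \<forall>i<?m. ?s \<le> card (F \<inter> T i)}"
    unfolding prob_turannical_def
  proof (rule random_hypergraph_prob_mono, intro allI impI)
    fix F i assume F: "F \<subseteq> nsets ?V 3" "turannical 3 ?V F" and i: "i < ?m"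
    show "?s \<le> card (F \<inter> T i)"
      using turannical_imp_large_codegree[OF _ F, of "2 * i + 1" "2 * i + 2"] i by (simp add: T_def)
  qed
  also have "\<dots> = measure_pmf.prob (?Pi (nsets ?V 3)) {f. \<forall>i<?m. ?s \<le> card {S \<in> T i. f S}}"
  proof -
    have "{S \<in> nsets ?V 3. f S} \<inter> T i = {S \<in> T i. f S}" for f i by (auto simp: T_def)
    thus ?thesis by (simp add: random_hypergraph_def vimage_def)
  qed
  also have "\<dots> = measure_pmf.prob (?Pi (\<Union>i<?m. T i)) {f. \<forall>i<?m. ?s \<le> card {S \<in> T i. f S}}"
  proof -
    have "{S \<in> T i. if S \<in> (\<Union>i<?m. T i) then f S else False} = {S \<in> T i. f S}" if "i < ?m" for f i
      using that by auto
    thus ?thesis unfolding Pi_pmf_subset[OF finN T_sub] measure_map_pmf vimage_def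
      by (intro arg_cong[of _ _ "measure_pmf.prob (?Pi (nsets ?V 3))"]) simp
  qed
  also have "\<dots> = (\<Prod>i<?m. measure_pmf.prob (binomial_pmf (card (T i)) p) {x. ?s \<le> x})"
    by (rule prob_disjoint_counts[OF finite_subset[OF T_sub finN] disj p01])
  also have "\<dots> \<le> (\<Prod>i<?m. 3 / 4)"
  proof (rule prod_mono, intro conjI)
    fix i assume "i \<in> {..<?m}"
    hence "measure_pmf.prob (binomial_pmf (card (T i)) p) {x. ?s \<le> x} = measure_pmf.prob (binomial_pmf (n - 2) p) {x. ?s \<le> x}"
      using cardT by simp
    also have "\<dots> \<le> measure_pmf.prob (binomial_pmf (n - 2) p) {x. n - 2 \<le> 2 * x}"
    proof (rule measure_pmf.finite_measure_mono)
      \<comment> \<open>Equality holds for even \<open>n\<close>. The event thus implies that at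
        least half of the \<open>n - 2\<close> triples through the pair are present, which
        \<open>binomial_upper_half\<close> controls.\<close>
      have "n - 2 \<le> 2 * ?s" by presburger
      thus "{x. ?s \<le> x} \<subseteq> {x. n - 2 \<le> 2 * x}" by auto
    qed simp
    also have "\<dots> \<le> 3 / 4" by (rule binomial_upper_half) (use p n in auto)
    finally show "measure_pmf.prob (binomial_pmf (card (T i)) p) {x. ?s \<le> x} \<le> 3 / 4" .
  qed simp
  finally show ?thesis by simp
qed

text \<open>The single pair of vertices 1 and 2 suffices: its mean codegree is at most
  \<open>n / (2 * (r - 1))\<close>, whereas a Turannical hypergraph needs about
  \<open>n / (r - 1)\<close>. The bound of \<open>binomial_upper_tail\<close> then decays because
  \<open>ln 2 > 1 / 2\<close>.\<close>

lemma prob_turannical_sparse_le: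
  assumes r: "r \<ge> 3" and p: "p \<in> {0..1}" and n: "n \<ge> 2"
    and sparse: "p * real n ^ (r - 2) \<le> real n / (2 * real (r - 1))"
  shows "prob_turannical r n p \<le> 2 * exp (- ((ln 2 - 1 / 2) / real (r - 1)) * real n)"
proof -
  define k where "k = r - 1"
  define s where "s = (n + k - 1) div k - 1"
  define T where "T = {S \<in> nsets {1..n} r. 1 \<in> S \<and> 2 \<in> S}"
  have k: "k \<ge> 2" using r by (simp add: k_def)
  have "card T \<le> card {1..n} ^ (r - 2)"
    unfolding T_def by (rule card_nsets_through_pair) auto
  hence "real (card T) \<le> real (n ^ (r - 2))" by (simp only: card_atLeastAtMost diff_Suc_1 of_nat_le_iff)
  hence "p * real (card T) \<le> p * real n ^ (r - 2)" using p by (intro mult_left_mono) auto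
  hence mean: "p * real (card T) \<le> real n / (2 * real k)" using sparse by (simp add: k_def)
  have s: "real s \<ge> real n / real k - 1"
  proof -
    have "n + k - 1 < (s + 2) * k"
    proof -
      have "n + k - 1 < ((n + k - 1) div k + 1) * k" using k by (simp add: dividend_less_div_times)
      also have "\<dots> \<le> (s + 2) * k" by (intro mult_right_mono) (auto simp: s_def)
      finally show ?thesis .
    qed
    hence "n \<le> (s + 1) * k" using k by simp
    hence "real n \<le> real ((s + 1) * k)" by (simp only: of_nat_le_iff)
    hence "real n / real k \<le> real (s + 1)" using k by (simp add: divide_le_eq distrib_right)
    thus ?thesis by simp
  qed
  have "prob_turannical r n p \<le> measure_pmf.prob (random_hypergraph r n p) {F. s \<le> card (F \<inter> T)}"
    unfolding prob_turannical_def s_def T_def k_def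
    by (rule random_hypergraph_prob_mono, rule turannical_imp_large_codegree) (use r n in auto)
  also have "\<dots> = measure_pmf.prob (binomial_pmf (card T) p) {x. s \<le> x}"
    by (rule random_hypergraph_card[OF _ p]) (auto simp: T_def)
  also have "\<dots> \<le> exp (p * real (card T)) / 2 ^ s" by (rule binomial_upper_tail[OF p])
  also have "\<dots> = exp (p * real (card T) - real s * ln 2)" by (simp add: exp_diff exp_of_nat_mult)
  also have "\<dots> \<le> exp (real n / (2 * real k) - (real n / real k - 1) * ln 2)"
    using mean s by (subst exp_le_cancel_iff, intro diff_mono mult_right_mono) auto
  also have "real n / (2 * real k) - (real n / real k - 1) * ln 2 = ln 2 + - ((ln 2 - 1 / 2) / real k) * real n"
    using k by (simp add: field_simps)
  also have "exp \<dots> = 2 * exp (- ((ln 2 - 1 / 2) / real k) * real n)" by (simp only: exp_add) simp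
  finally show ?thesis by (simp add: k_def)
qed

section \<open>The 1-statements\<close>

lemma not_turannicalE:
  assumes "\<not> turannical r {1..n} F" "F \<subseteq> nsets {1..n} r"
  obtains E where "E \<subseteq> nsets {1..n} 2" "card E > turan_number r n" "\<not> detects r F E" "F \<inter> cliques r E {1..n} = {}"
  using assms detects_iff[OF _ assms(2)] unfolding turannical_def by fastforce

text \<open>A graph above the Turan number is never itself complete \<open>(r - 1)\<close>-partite,
  so its distance is at least 1 and \<open>prob_far_undetected\<close> applies with
  \<open>L = 1\<close>. The choice \<open>\<beta> = ln (r - 1) + 1\<close> outweighs the number of
  partitions, and \<open>C = 2 * \<beta> / c\<close> makes \<open>p\<close> large enough for it. For
  \<open>r = 3\<close> this \<open>C\<close> may exceed 1, hence the separate treatment of constant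
  \<open>p\<close>.\<close>

lemma prob_turannical_dense_ge:
  assumes r: "r \<ge> 3"
  shows "\<exists>C>0. \<forall>n p. n \<ge> r \<longrightarrow> p \<in> {0..1} \<longrightarrow> p * real n ^ (r - 2) \<ge> C * real n \<longrightarrow>
    prob_turannical r n p \<ge> 1 - exp (- real n) * exp (real n ^ 2 * exp (- (ln (real (r - 1)) + 1) * real n))"
proof -
  from many_cliques_distance[OF r, where ?'a = nat] obtain c where c: "c > 0" and
    many: "\<forall>(V :: nat set) E. finite V \<longrightarrow> card V \<ge> r - 1 \<longrightarrow> E \<subseteq> nsets V 2 \<longrightarrow>
    card E > turan_number r (card V) \<longrightarrow>
    (\<exists>f \<in> V \<rightarrow>\<^sub>E {..<r - 1}. real (card (cliques r E V)) \<ge>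
        c * real (card (sym_diff E (multipartite f V))) * real (card V) ^ (r - 2))" by blast
  define \<beta> where "\<beta> = ln (real (r - 1)) + 1"
  have \<beta>: "\<beta> > 0" using r by (simp add: \<beta>_def add_nonneg_pos)
  show ?thesis
  proof (intro exI[of _ "2 * \<beta> / c"] conjI allI impI)
    show "2 * \<beta> / c > 0" using \<beta> c by simp
    fix n p assume n: "n \<ge> r" and p: "p \<in> {0..1 :: real}" and dense: "p * real n ^ (r - 2) \<ge> 2 * \<beta> / c * real n"
    let ?V = "{1..n}" and ?M = "random_hypergraph r n p"
    have "measure_pmf.prob ?M {F. \<not> turannical r ?V F} \<le> measure_pmf.prob ?M
      {F. \<exists>E. E \<subseteq> nsets ?V 2 \<and> card E > turan_number r n \<and> F \<inter> cliques r E ?V = {} \<and>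
        (\<forall>f \<in> ?V \<rightarrow>\<^sub>E {..<r - 1}. 1 \<le> card (sym_diff E (multipartite f ?V)))}"
    proof (rule random_hypergraph_prob_mono)
      fix F assume F: "F \<subseteq> nsets ?V r" "\<not> turannical r ?V F"
      from not_turannicalE[OF F(2,1)] obtain E where E: "E \<subseteq> nsets ?V 2" "card E > turan_number r n"
        "F \<inter> cliques r E ?V = {}" by metis
      have "1 \<le> card (sym_diff E (multipartite f ?V))" if f: "f \<in> ?V \<rightarrow>\<^sub>E {..<r - 1}" for f
      proof -
        have "card (multipartite f ?V) \<le> turan_number r n"
          using card_multipartite_le_turan[of r ?V f] r f by auto
        hence "E \<noteq> multipartite f ?V" using E(2) by auto
        hence "sym_diff E (multipartite f ?V) \<noteq> {}" by blast
        moreover have "sym_diff E (multipartite f ?V) \<subseteq> nsets ?V 2"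
          using E(1) multipartite_subset[of f ?V] by auto
        hence "finite (sym_diff E (multipartite f ?V))"
          by (rule finite_subset) (simp add: finite_imp_finite_nsets)
        ultimately show ?thesis by (metis card_gt_0_iff One_nat_def Suc_leI)
      qed
      thus "\<exists>E. E \<subseteq> nsets ?V 2 \<and> card E > turan_number r n \<and> F \<inter> cliques r E ?V = {} \<and>
        (\<forall>f \<in> ?V \<rightarrow>\<^sub>E {..<r - 1}. 1 \<le> card (sym_diff E (multipartite f ?V)))" using E by blast
    qed
    also have "\<dots> \<le> exp (- real n) * exp (real n ^ 2 * exp (- \<beta> * real n))"
    proof (rule prob_far_undetected[OF r p c])
      show "\<exists>f \<in> ?V \<rightarrow>\<^sub>E {..<r - 1}. real (card (cliques r E ?V)) \<ge>
        c * real (card (sym_diff E (multipartite f ?V))) * real n ^ (r - 2)"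
        if "E \<subseteq> nsets ?V 2" "card E > turan_number r n" for E
        using many[rule_format, of ?V E] that n by simp
      have "c * (2 * \<beta> / c * real n) \<le> c * (p * real n ^ (r - 2))" using dense c by (intro mult_left_mono) auto
      thus "2 * \<beta> * real n \<le> p * c * real n ^ (r - 2)" using c by (simp add: mult.assoc mult.left_commute)
    qed (use \<beta> in \<open>auto simp: \<beta>_def\<close>)
    finally show "prob_turannical r n p \<ge> 1 - exp (- real n) * exp (real n ^ 2 * exp (- (ln (real (r - 1)) + 1) * real n))"
      unfolding prob_turannical_compl \<beta>_def by simp
  qed
qed

text \<open>Hoeffding's inequality for the \<open>n - 2\<close> triples through a fixed pair, with a
  union bound over ordered pairs. The density \<open>1 / 2 + \<epsilon>\<close> lies halfway between
  \<open>1 / 2\<close> and \<open>p\<close>: one \<open>\<epsilon>\<close> is the deviation used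
  here, the other remains as slack for \<open>detects_near_bipartite\<close>.\<close>

lemma prob_small_codegree:
  assumes n: "n \<ge> 3" and \<epsilon>: "\<epsilon> \<ge> 0" and p: "p \<in> {0..1}" "p = 1 / 2 + 2 * \<epsilon>"
  shows "measure_pmf.prob (random_hypergraph 3 n p)
    {F. \<exists>u v. u \<in> {1..n} \<and> v \<in> {1..n} \<and> u \<noteq> v \<and>
       real (card {z \<in> {1..n} - {u, v}. {u, v, z} \<in> F}) < (1 / 2 + \<epsilon>) * real n - 2}
    \<le> real n ^ 2 * exp (- 2 * (real n - 2) * \<epsilon> ^ 2)"
proof -
  let ?V = "{1..n}" and ?M = "random_hypergraph 3 n p"
  define I where "I = {(u, v). u \<in> ?V \<and> v \<in> ?V \<and> u \<noteq> v}"
  define B where "B i = {F. case i of (u, v) \<Rightarrow> F \<subseteq> nsets ?V 3 \<and>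
     real (card {z \<in> ?V - {u, v}. {u, v, z} \<in> F}) < (1 / 2 + \<epsilon>) * real n - 2}" for i
  have finI: "finite I" unfolding I_def by (rule finite_subset[of _ "?V \<times> ?V"]) auto
  have cardI: "card I \<le> n * n"
  proof -
    have "card I \<le> card (?V \<times> ?V)" by (rule card_mono) (auto simp: I_def)
    thus ?thesis by simp
  qed
  have B: "measure_pmf.prob ?M (B i) \<le> exp (- 2 * (real n - 2) * \<epsilon> ^ 2)" if "i \<in> I" for i
  proof -
    obtain u v where i: "i = (u, v)" by (cases i)
    have uv: "u \<in> ?V" "v \<in> ?V" "u \<noteq> v" using that by (auto simp: I_def i)
    let ?T = "(\<lambda>z. {u, v, z}) ` (?V - {u, v})"
    have inj: "inj_on (\<lambda>z. {u, v, z}) (?V - {u, v})" by (auto simp: inj_on_def)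
    have "card ?T = card (?V - {u, v})" by (rule card_image[OF inj])
    also have "\<dots> = card ?V - card {u, v}" by (rule card_Diff_subset) (use uv in auto)
    finally have cardT: "card ?T = n - 2" using uv by simp
    have T: "?T \<subseteq> nsets ?V 3" using uv by (auto simp: nsets_def)
    have count: "card (F \<inter> ?T) = card {z \<in> ?V - {u, v}. {u, v, z} \<in> F}" for F
    proof -
      have "F \<inter> ?T = (\<lambda>z. {u, v, z}) ` {z \<in> ?V - {u, v}. {u, v, z} \<in> F}" by auto
      moreover have "card ((\<lambda>z. {u, v, z}) ` {z \<in> ?V - {u, v}. {u, v, z} \<in> F}) = card {z \<in> ?V - {u, v}. {u, v, z} \<in> F}"
        by (rule card_image[OF inj_on_subset[OF inj]]) auto
      ultimately show ?thesis by (simp only:)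
    qed
    have "measure_pmf.prob ?M (B i) \<le> measure_pmf.prob ?M {F. real (card (F \<inter> ?T)) / real (n - 2) \<le> p - \<epsilon>}"
      unfolding B_def i prod.case
    proof (rule random_hypergraph_prob_mono)
      fix F assume "F \<subseteq> nsets ?V 3 \<and> real (card {z \<in> ?V - {u, v}. {u, v, z} \<in> F}) < (1 / 2 + \<epsilon>) * real n - 2"
      hence "real (card (F \<inter> ?T)) \<le> (1 / 2 + \<epsilon>) * real n - 2" unfolding count by simp
      \<comment> \<open>This uses \<open>1 / 2 + \<epsilon> \<le> p \<le> 1\<close>, so that
        multiplying the 2 by this factor only decreases it.\<close>
      also have "\<dots> \<le> (1 / 2 + \<epsilon>) * (real n - 2)" using p \<epsilon> by (simp add: right_diff_distrib)
      also have "\<dots> = (p - \<epsilon>) * real (n - 2)" using n p by (simp add: of_nat_diff)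
      finally show "real (card (F \<inter> ?T)) / real (n - 2) \<le> p - \<epsilon>" using n by (simp add: divide_le_eq)
    qed
    also have "\<dots> = measure_pmf.prob (binomial_pmf (n - 2) p) {x. real x / real (n - 2) \<le> p - \<epsilon>}"
      using random_hypergraph_card[OF T p(1)] cardT by simp
    also have "\<dots> \<le> exp (- 2 * real (n - 2) * \<epsilon> ^ 2)"
    proof -
      have "binomial_distribution p" by unfold_locales (rule p)
      from binomial_distribution.prob_le'[OF this, of "n - 2" \<epsilon>]
      show ?thesis using n \<epsilon> by (simp del: of_nat_diff)
    qed
    also have "real (n - 2) = real n - 2" using n by (simp add: of_nat_diff)
    finally show ?thesis .
  qed
  have "measure_pmf.prob ?M {F. \<exists>u v. u \<in> ?V \<and> v \<in> ?V \<and> u \<noteq> v \<and>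
       real (card {z \<in> ?V - {u, v}. {u, v, z} \<in> F}) < (1 / 2 + \<epsilon>) * real n - 2}
     \<le> measure_pmf.prob ?M {F. F \<in> (\<Union>i\<in>I. B i)}"
    by (rule random_hypergraph_prob_mono) (auto simp: I_def B_def)
  also have "\<dots> \<le> (\<Sum>i\<in>I. measure_pmf.prob ?M (B i))"
    unfolding Collect_mem_eq by (rule measure_pmf.finite_measure_subadditive_finite[OF finI]) simp
  also have "\<dots> \<le> (\<Sum>i\<in>I. exp (- 2 * (real n - 2) * \<epsilon> ^ 2))" by (rule sum_mono) (rule B)
  also have "\<dots> = real (card I) * exp (- 2 * (real n - 2) * \<epsilon> ^ 2)" by simp
  also have "\<dots> \<le> real (n * n) * exp (- 2 * (real n - 2) * \<epsilon> ^ 2)"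
    using cardI by (intro mult_right_mono) (simp_all only: of_nat_le_iff exp_ge_zero)
  finally show ?thesis by (simp add: power2_eq_square)
qed

lemma prob_turannical_3_ge:
  assumes p: "1 / 2 < p" "p \<le> 1"
  shows "\<exists>\<beta>>0. \<exists>\<epsilon>>0. \<forall>\<^sub>F n in sequentially. prob_turannical 3 n p \<ge>
    1 - (exp (- real n) * exp (real n ^ 2 * exp (- \<beta> * real n)) + real n ^ 2 * exp (- 2 * (real n - 2) * \<epsilon> ^ 2))"
proof -
  from many_cliques_distance[of 3, where ?'a = nat] obtain c where c: "c > 0" and
    many: "\<forall>(V :: nat set) E. finite V \<longrightarrow> card V \<ge> 3 - 1 \<longrightarrow> E \<subseteq> nsets V 2 \<longrightarrow>
    card E > turan_number 3 (card V) \<longrightarrow>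
    (\<exists>f \<in> V \<rightarrow>\<^sub>E {..<3 - 1}. real (card (cliques 3 E V)) \<ge>
        c * real (card (sym_diff E (multipartite f V))) * real (card V) ^ (3 - 2))" by blast
  \<comment> \<open>As \<open>p\<close> is a fixed number, \<open>\<beta>\<close> is dictated by
    \<open>p * c\<close> and may be small. Instead, the number \<open>L\<close> of changed pairs is
    taken large enough to outweigh the \<open>2 ^ n\<close> partitions.\<close>
  define \<beta> where "\<beta> = p * c / 2"
  define \<epsilon> where "\<epsilon> = (p - 1 / 2) / 2"
  define L where "L = nat \<lceil>(ln 2 + 1) / \<beta>\<rceil>"
  have \<beta>: "\<beta> > 0" using p c by (simp add: \<beta>_def)
  have \<epsilon>: "\<epsilon> > 0" using p by (simp add: \<epsilon>_def)
  have p01: "p \<in> {0..1}" using p by auto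
  have "real L \<ge> (ln 2 + 1) / \<beta>" by (simp add: L_def real_nat_ceiling_ge)
  hence L: "real L * \<beta> \<ge> ln (real (3 - 1)) + 1" using \<beta> by (simp add: divide_le_eq)
  have "\<forall>\<^sub>F n in sequentially. real n \<ge> (4 * real L + 4) / \<epsilon>"
    using filterlim_real_sequentially by (auto simp: filterlim_at_top)
  hence ev: "\<forall>\<^sub>F n in sequentially. real n \<ge> (4 * real L + 4) / \<epsilon> \<and> n \<ge> 3"
    by (intro eventually_conj eventually_ge_at_top)
  show ?thesis
  proof (rule exI[of _ \<beta>], rule conjI[OF \<beta>], rule exI[of _ \<epsilon>], rule conjI[OF \<epsilon>],
      rule eventually_mono[OF ev], elim conjE)
    fix n assume n_eps: "real n \<ge> (4 * real L + 4) / \<epsilon>" and n: "n \<ge> 3"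
    let ?V = "{1..n}" and ?M = "random_hypergraph 3 n p"
    have big: "\<epsilon> * real n \<ge> 4 * real L + 4" using n_eps \<epsilon> by (simp add: divide_le_eq mult.commute)
    define A where "A = {F. \<exists>E. E \<subseteq> nsets ?V 2 \<and> card E > turan_number 3 n \<and> F \<inter> cliques 3 E ?V = {} \<and>
        (\<forall>f \<in> ?V \<rightarrow>\<^sub>E {..<3 - 1}. L \<le> card (sym_diff E (multipartite f ?V)))}"
    define B where "B = {F. \<exists>u v. u \<in> ?V \<and> v \<in> ?V \<and> u \<noteq> v \<and>
       real (card {z \<in> ?V - {u, v}. {u, v, z} \<in> F}) < (1 / 2 + \<epsilon>) * real n - 2}"
    \<comment> \<open>An undetected graph at distance less than \<open>L\<close> from some
      bipartition requires a small codegree, by \<open>detects_near_bipartite\<close>; every other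
      undetected graph puts \<open>F\<close> into \<open>A\<close>.\<close>
    have "measure_pmf.prob ?M {F. \<not> turannical 3 ?V F} \<le> measure_pmf.prob ?M {F. F \<in> A \<union> B}"
    proof (rule random_hypergraph_prob_mono)
      fix F assume F: "F \<subseteq> nsets ?V 3" "\<not> turannical 3 ?V F"
      from not_turannicalE[OF F(2,1)] obtain E where E: "E \<subseteq> nsets ?V 2" "card E > turan_number 3 n"
        "\<not> detects 3 F E" "F \<inter> cliques 3 E ?V = {}" by metis
      show "F \<in> A \<union> B"
      proof (rule ccontr)
        assume notin: "F \<notin> A \<union> B"
        hence "F \<notin> A" by simp
        hence "\<not> (\<forall>f \<in> ?V \<rightarrow>\<^sub>E {..<3 - 1}. L \<le> card (sym_diff E (multipartite f ?V)))"
          using E unfolding A_def by blast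
        then obtain f where f: "f \<in> ?V \<rightarrow>\<^sub>E {..<3 - 1}" "card (sym_diff E (multipartite f ?V)) < L"
          by (auto simp: not_le)
        have "detects 3 F E"
        proof (rule detects_near_bipartite[OF _ _ _ E(1,2) f(2) F(1) _ big])
          show "f \<in> ?V \<rightarrow> {..<2}" using f(1) by auto
          show "real (card {z \<in> ?V - {u, v}. {u, v, z} \<in> F}) \<ge> (1 / 2 + \<epsilon>) * real n - 2"
            if "u \<in> ?V" "v \<in> ?V" "u \<noteq> v" for u v
            using notin that unfolding B_def by (auto simp: not_less)
        qed auto
        thus False using E(3) by simp
      qed
    qed
    also have "\<dots> \<le> measure_pmf.prob ?M A + measure_pmf.prob ?M B"
      unfolding Collect_mem_eq by (rule measure_Un_le) auto
    also have "measure_pmf.prob ?M A \<le> exp (- real n) * exp (real n ^ 2 * exp (- \<beta> * real n))"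
      unfolding A_def
    proof (rule prob_far_undetected[OF _ p01 c])
      show "\<exists>f \<in> ?V \<rightarrow>\<^sub>E {..<3 - 1}. real (card (cliques 3 E ?V)) \<ge>
        c * real (card (sym_diff E (multipartite f ?V))) * real n ^ (3 - 2)"
        if "E \<subseteq> nsets ?V 2" "card E > turan_number 3 n" for E
        using many[rule_format, of ?V E] that n by simp
    qed (use L \<beta> in \<open>auto simp: \<beta>_def\<close>)
    also have "measure_pmf.prob ?M B \<le> real n ^ 2 * exp (- 2 * (real n - 2) * \<epsilon> ^ 2)"
      unfolding B_def by (rule prob_small_codegree[OF n _ p01]) (use \<epsilon> in \<open>auto simp: \<epsilon>_def field_simps\<close>)
    finally show "prob_turannical 3 n p \<ge>
      1 - (exp (- real n) * exp (real n ^ 2 * exp (- \<beta> * real n)) + real n ^ 2 * exp (- 2 * (real n - 2) * \<epsilon> ^ 2))"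
      unfolding prob_turannical_compl by simp
  qed
qed

lemma prob_turannical_nonneg: "prob_turannical r n p \<ge> 0"
  and prob_turannical_le_1: "prob_turannical r n p \<le> 1"
  by (simp_all add: prob_turannical_def)

lemma tendsto_prob_turannical_0I:
  assumes "\<forall>\<^sub>F n in sequentially. prob_turannical r n (p n) \<le> b n" "b \<longlonglongrightarrow> 0"
  shows "(\<lambda>n. prob_turannical r n (p n)) \<longlonglongrightarrow> 0"
  by (rule tendsto_sandwich[OF _ assms(1) tendsto_const assms(2)]) (simp add: prob_turannical_nonneg)

lemma tendsto_prob_turannical_1I:
  assumes "\<forall>\<^sub>F n in sequentially. prob_turannical r n (p n) \<ge> 1 - b n" "b \<longlonglongrightarrow> 0"
  shows "(\<lambda>n. prob_turannical r n (p n)) \<longlonglongrightarrow> 1"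
proof (rule tendsto_sandwich[OF assms(1) _ _ tendsto_const])
  show "(\<lambda>n. 1 - b n) \<longlonglongrightarrow> 1" using tendsto_diff[OF tendsto_const[of 1] assms(2)] by simp
qed (simp add: prob_turannical_le_1)

lemma tendsto_prob_turannical_3:
  fixes p :: real
  assumes "0 \<le> p" "p \<le> 1"
  shows "(\<lambda>n. prob_turannical 3 n p) \<longlonglongrightarrow> (if p \<le> 1 / 2 then 0 else 1)"
proof (cases "p \<le> 1 / 2")
  case True
  have "(\<lambda>n. prob_turannical 3 n p) \<longlonglongrightarrow> 0"
  proof (rule tendsto_prob_turannical_0I)
    show "\<forall>\<^sub>F n in sequentially. prob_turannical 3 n p \<le> (3 / 4) ^ (n div 2)"
      using eventually_ge_at_top[of 3] by eventually_elim (rule prob_turannical_3_le[OF assms(1) True])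
    show "(\<lambda>n. (3 / 4 :: real) ^ (n div 2)) \<longlonglongrightarrow> 0" by real_asymp
  qed
  thus ?thesis using True by simp
next
  case False
  from prob_turannical_3_ge[of p] False assms obtain \<beta> \<epsilon> where pos: "\<beta> > 0" "\<epsilon> > 0" and
    ev: "\<forall>\<^sub>F n in sequentially. prob_turannical 3 n p \<ge>
    1 - (exp (- real n) * exp (real n ^ 2 * exp (- \<beta> * real n)) + real n ^ 2 * exp (- 2 * (real n - 2) * \<epsilon> ^ 2))"
    by auto
  have "(\<lambda>n. exp (- real n) * exp (real n ^ 2 * exp (- \<beta> * real n)) + real n ^ 2 * exp (- 2 * (real n - 2) * \<epsilon> ^ 2)) \<longlonglongrightarrow> 0 + 0"
    by (rule tendsto_add) (use pos in real_asymp)+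
  hence "(\<lambda>n. prob_turannical 3 n p) \<longlonglongrightarrow> 1"
    by (intro tendsto_prob_turannical_1I[OF ev]) simp
  thus ?thesis using False by simp
qed

lemma powi_threshold:
  assumes "n > 0" "r \<ge> 3"
  shows "real n powi (3 - int r) * real n ^ (r - 2) = real n"
proof -
  have "real n powi (3 - int r) * real n powi int (r - 2) = real n powi (3 - int r + int (r - 2))"
    using assms by (intro power_int_add[symmetric]) auto
  also have "3 - int r + int (r - 2) = 1" using assms by simp
  finally show ?thesis by simp
qed

text \<open>The bounds on \<open>p n\<close> are required only for large \<open>n\<close>. For small
  \<open>n\<close> the value \<open>C * real n powi (3 - int r)\<close> may exceed 1, and then no
  sequence of probabilities would lie above it everywhere. The version with bounds for all
  \<open>n\<close> follows at once.\<close>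

theorem theorem2p4:
  shows "(\<forall>p::real. 0 \<le> p \<and> p \<le> 1 \<longrightarrow>
            (\<lambda>n. prob_turannical 3 n p) \<longlonglongrightarrow> (if p \<le> 1/2 then 0 else 1)) \<and>
         (\<forall>r::nat. r > 3 \<longrightarrow>
            (\<exists>c::real. \<exists>C::real. c > 0 \<and> C > 0 \<and>
              (\<forall>p::nat \<Rightarrow> real. (\<forall>n. 0 \<le> p n \<and> p n \<le> 1) \<longrightarrow>
                 ((\<forall>\<^sub>F n in sequentially. p n \<le> c * real n powi (3 - int r)) \<longrightarrow>
                    (\<lambda>n. prob_turannical r n (p n)) \<longlonglongrightarrow> 0) \<and>
                 ((\<forall>\<^sub>F n in sequentially. p n \<ge> C * real n powi (3 - int r)) \<longrightarrow>
                    (\<lambda>n. prob_turannical r n (p n)) \<longlonglongrightarrow> 1))))"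
proof (intro conjI allI impI)
  fix p :: real assume "0 \<le> p \<and> p \<le> 1"
  thus "(\<lambda>n. prob_turannical 3 n p) \<longlonglongrightarrow> (if p \<le> 1/2 then 0 else 1)"
    using tendsto_prob_turannical_3 by blast
next
  fix r :: nat assume "r > 3"
  hence r: "r \<ge> 3" by simp
  from prob_turannical_dense_ge[OF r] obtain C where C: "C > 0" and
    ge: "\<And>n p. n \<ge> r \<Longrightarrow> p \<in> {0..1} \<Longrightarrow> p * real n ^ (r - 2) \<ge> C * real n \<Longrightarrow>
    prob_turannical r n p \<ge> 1 - exp (- real n) * exp (real n ^ 2 * exp (- (ln (real (r - 1)) + 1) * real n))"
    by blast
  \<comment> \<open>Half of the relative class size \<open>1 / (r - 1)\<close>, as
    \<open>prob_turannical_sparse_le\<close> demands.\<close>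
  define c where "c = 1 / (2 * real (r - 1))"
  show "\<exists>c::real. \<exists>C::real. c > 0 \<and> C > 0 \<and>
              (\<forall>p::nat \<Rightarrow> real. (\<forall>n. 0 \<le> p n \<and> p n \<le> 1) \<longrightarrow>
                 ((\<forall>\<^sub>F n in sequentially. p n \<le> c * real n powi (3 - int r)) \<longrightarrow>
                    (\<lambda>n. prob_turannical r n (p n)) \<longlonglongrightarrow> 0) \<and>
                 ((\<forall>\<^sub>F n in sequentially. p n \<ge> C * real n powi (3 - int r)) \<longrightarrow>
                    (\<lambda>n. prob_turannical r n (p n)) \<longlonglongrightarrow> 1))"
  proof (rule exI[of _ c], rule exI[of _ C], intro conjI allI impI C)
    show "c > 0" using r by (simp add: c_def)
  next
    fix p :: "nat \<Rightarrow> real"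
    assume p: "\<forall>n. 0 \<le> p n \<and> p n \<le> 1" and sparse: "\<forall>\<^sub>F n in sequentially. p n \<le> c * real n powi (3 - int r)"
    let ?d = "(ln 2 - 1 / 2) / real (r - 1)"
    show "(\<lambda>n. prob_turannical r n (p n)) \<longlonglongrightarrow> 0"
    proof (rule tendsto_prob_turannical_0I)
      show "\<forall>\<^sub>F n in sequentially. prob_turannical r n (p n) \<le> 2 * exp (- ?d * real n)"
        using sparse eventually_ge_at_top[of 2]
      proof eventually_elim
        case (elim n)
        have "p n * real n ^ (r - 2) \<le> c * real n powi (3 - int r) * real n ^ (r - 2)"
          using elim(1) by (intro mult_right_mono) auto
        also have "\<dots> = real n / (2 * real (r - 1))"
          using elim(2) r by (simp add: mult.assoc powi_threshold c_def)
        finally show ?case using p elim(2) by (intro prob_turannical_sparse_le[OF r]) auto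
      qed
      have "(\<lambda>n. 2 * exp (- d * real n)) \<longlonglongrightarrow> 0" if "d > 0" for d :: real
        using that by real_asymp
      moreover have "?d > 0" using ln2_ge_two_thirds r by (intro divide_pos_pos) auto
      ultimately show "(\<lambda>n. 2 * exp (- ?d * real n)) \<longlonglongrightarrow> 0" by blast
    qed
  next
    fix p :: "nat \<Rightarrow> real"
    assume p: "\<forall>n. 0 \<le> p n \<and> p n \<le> 1" and dense: "\<forall>\<^sub>F n in sequentially. p n \<ge> C * real n powi (3 - int r)"
    show "(\<lambda>n. prob_turannical r n (p n)) \<longlonglongrightarrow> 1"
    proof (rule tendsto_prob_turannical_1I)
      show "\<forall>\<^sub>F n in sequentially. prob_turannical r n (p n) \<ge>
          1 - exp (- real n) * exp (real n ^ 2 * exp (- (ln (real (r - 1)) + 1) * real n))"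
        using dense eventually_ge_at_top[of r]
      proof eventually_elim
        case (elim n)
        have "C * real n = C * real n powi (3 - int r) * real n ^ (r - 2)"
          using elim(2) r by (simp add: mult.assoc powi_threshold)
        also have "\<dots> \<le> p n * real n ^ (r - 2)" using elim(1) by (intro mult_right_mono) auto
        finally show ?case using p elim(2) by (intro ge) auto
      qed
      have "ln (real (r - 1)) + 1 > 0" using r by (simp add: add_nonneg_pos)
      thus "(\<lambda>n. exp (- real n) * exp (real n ^ 2 * exp (- (ln (real (r - 1)) + 1) * real n))) \<longlonglongrightarrow> 0"
        by real_asymp
    qed
  qed
qed

end
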